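(* Let $a\in C^\infty(\mathbb T;\mathbb R)$, $a_0=\frac1{2\pi}\int_0^{2\pi}a(t)\,dt$, $L=\partial_t-a(t)\partial_x$, $L_0=\partial_t-a_0\partial_x$, and $A(t)=\int_0^t(a(\sigma)-a_0)\,d\sigma$ (a $2\pi$-periodic smooth function). For $u\in\mathcal D'(\mathbb T^2)$, set $$(\Psi_{\pm A}u)(t,x)=u(t,x\mp A(t)),$$ where the expression is understood as pullback by the corresponding smooth diffeomorphism. Then $\Psi_A$ and $\Psi_{-A}$ are mutually inverse continuous automorphisms of $\mathcal D'(\mathbb T^2)$ and of $C^\infty(\mathbb T^2)$. Moreover, $$\Psi_AL=L_0\Psi_A,\qquad \Psi_{-A}L_0=L\Psi_{-A},$$ and, for every $u\in\mathcal D'(\mathbb T^2)$ and every $\xi\in\mathbb Z$, $$\widehat{\Psi_{\pm A}u}(t,\xi)=e^{\mp i\xi A(t)}\,\widehat u(t,\xi).$$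
   Context: $\mathbb T=\mathbb R/2\pi\mathbb Z$, with variables $(t,x)\in\mathbb T^2$. $\mathcal D'(\mathbb T^2)$ is the space of distributions on $\mathbb T^2$. The partial Fourier coefficient in $x$ is $\widehat f(t,\xi)=\frac1{2\pi}\int_{\mathbb T}f(t,x)e^{-ix\xi}\,dx$, $\xi\in\mathbb Z$; for $f\in\mathcal D'(\mathbb T^2)$, $\widehat f(\cdot,\xi)$ is an element of $\mathcal D'(\mathbb T)$ defined by duality. *)

theory Defs
  imports "HOL-Analysis.Analysis"
begin

section \<open>Smooth functions on a torus\<close>

text \<open>
  For a Euclidean space \<open>'a\<close> (here \<open>real\<close> or \<open>real \<times> real\<close>), functions on the torus
  \<open>'a / (2 * pi * Z)\<close>, with \<open>Z\<close> the lattice generated by the standard basis, are represented by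
  functions on \<open>'a\<close> that are \<open>2 * pi\<close>-periodic in every coordinate direction.
\<close>

definition dir_deriv ::
  "'a::euclidean_space \<Rightarrow> ('a \<Rightarrow> 'b::real_normed_vector) \<Rightarrow> 'a \<Rightarrow> 'b" where
  "dir_deriv v f = (\<lambda>x. frechet_derivative f (at x) v)"

primrec C_k :: "nat \<Rightarrow> ('a::euclidean_space \<Rightarrow> 'b::real_normed_vector) \<Rightarrow> bool" where
  "C_k 0 f \<longleftrightarrow> continuous_on UNIV f"
| "C_k (Suc k) f \<longleftrightarrow> (\<forall>x. f differentiable (at x)) \<and> (\<forall>v. C_k k (dir_deriv v f))"

definition torus_smooth :: "('a::euclidean_space \<Rightarrow> 'b::real_normed_vector) set" where
  "torus_smooth =
     {f. (\<forall>k. C_k k f) \<and> (\<forall>x. \<forall>b\<in>Basis. f (x + (2 * pi) *\<^sub>R b) = f x)}"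

section \<open>Topologies given by seminorms\<close>

definition seminorm_topology ::
  "('i \<Rightarrow> complex) set \<Rightarrow> (('i \<Rightarrow> complex) \<Rightarrow> real) set \<Rightarrow> ('i \<Rightarrow> complex) topology" where
  "seminorm_topology S P =
     topology_generated_by
       {{g \<in> S. p (\<lambda>i. g i - f i) < e} | f p e. f \<in> S \<and> p \<in> P \<and> 0 < (e::real)}"

text \<open>
  The Frechet topology of \<open>C\<^sup>\<infinity>\<close>: uniform convergence of all partial derivatives. A list of basis
  vectors lists the directions of the successive partial derivatives.
\<close>

definition torus_seminorm :: "'a::euclidean_space list \<Rightarrow> ('a \<Rightarrow> complex) \<Rightarrow> real" where
  "torus_seminorm vs f = (SUP x. norm (foldr dir_deriv vs f x))"

definition torus_smooth_topology :: "('a::euclidean_space \<Rightarrow> complex) topology" where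
  "torus_smooth_topology =
     seminorm_topology torus_smooth {torus_seminorm vs | vs. set vs \<subseteq> Basis}"

definition torus_bounded :: "('a::euclidean_space \<Rightarrow> complex) set \<Rightarrow> bool" where
  "torus_bounded B \<longleftrightarrow>
     B \<subseteq> torus_smooth \<and> (\<forall>vs. set vs \<subseteq> Basis \<longrightarrow> bdd_above (torus_seminorm vs ` B))"

section \<open>Distributions on a torus\<close>

text \<open>
  Distributions are the continuous complex-linear functionals on \<open>C\<^sup>\<infinity>\<close>, made extensional
  (undefined outside \<open>C\<^sup>\<infinity>\<close>) so that equality of functions is equality of distributions.
  A function \<open>f\<close> corresponds to the functional sending \<open>\<phi>\<close> to the integral of \<open>f * \<phi>\<close> over
  a period cell; the pairing is bilinear, without complex conjugation and without normalising
  factor. This fixes the signs in the operations below.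
\<close>

definition torus_dist :: "(('a::euclidean_space \<Rightarrow> complex) \<Rightarrow> complex) set" where
  "torus_dist =
     {u \<in> extensional torus_smooth.
        (\<forall>\<phi>\<in>torus_smooth. \<forall>\<psi>\<in>torus_smooth. \<forall>c d.
           u (\<lambda>x. c * \<phi> x + d * \<psi> x) = c * u \<phi> + d * u \<psi>) \<and>
        continuous_map torus_smooth_topology euclidean u}"

definition weak_dist_topology ::
  "(('a::euclidean_space \<Rightarrow> complex) \<Rightarrow> complex) topology" where
  "weak_dist_topology =
     seminorm_topology torus_dist {(\<lambda>u. norm (u \<phi>)) | \<phi>. \<phi> \<in> torus_smooth}"

definition strong_dist_topology ::
  "(('a::euclidean_space \<Rightarrow> complex) \<Rightarrow> complex) topology" where
  "strong_dist_topology =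
     seminorm_topology torus_dist
       {(\<lambda>u. SUP \<phi>\<in>B. norm (u \<phi>)) | B. B \<noteq> {} \<and> torus_bounded B}"

definition dist_deriv ::
  "'a::euclidean_space \<Rightarrow> (('a \<Rightarrow> complex) \<Rightarrow> complex) \<Rightarrow> (('a \<Rightarrow> complex) \<Rightarrow> complex)" where
  "dist_deriv v u = (\<lambda>\<phi>\<in>torus_smooth. - u (dir_deriv v \<phi>))"

definition dist_mult ::
  "('a::euclidean_space \<Rightarrow> complex) \<Rightarrow> (('a \<Rightarrow> complex) \<Rightarrow> complex) \<Rightarrow> (('a \<Rightarrow> complex) \<Rightarrow> complex)"
  where "dist_mult m u = (\<lambda>\<phi>\<in>torus_smooth. u (\<lambda>x. m x * \<phi> x))"

definition jacobian2 :: "(real \<times> real \<Rightarrow> real \<times> real) \<Rightarrow> real \<times> real \<Rightarrow> real" where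
  "jacobian2 G p =
     fst (dir_deriv (1, 0) G p) * snd (dir_deriv (0, 1) G p) -
     fst (dir_deriv (0, 1) G p) * snd (dir_deriv (1, 0) G p)"

text \<open>
  Pullback by a diffeomorphism of the two-dimensional torus, given by a lift \<open>F\<close> to the plane.
  The formula is the change of variables \<open>q = F p\<close> in the integral of \<open>u (F p) * \<phi> p\<close>.
\<close>

definition dist_pullback ::
  "(real \<times> real \<Rightarrow> real \<times> real) \<Rightarrow>
   ((real \<times> real \<Rightarrow> complex) \<Rightarrow> complex) \<Rightarrow> ((real \<times> real \<Rightarrow> complex) \<Rightarrow> complex)" where
  "dist_pullback F u =
     (\<lambda>\<phi>\<in>torus_smooth. u (\<lambda>q. complex_of_real \<bar>jacobian2 (inv F) q\<bar> * \<phi> (inv F q)))"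

text \<open>
  The partial Fourier coefficient in \<open>x\<close>: integrating \<open>1 / (2 * pi) * \<integral> f t x * exp (- i * x * \<xi>) dx\<close>
  against \<open>\<psi> t\<close> pairs \<open>f\<close> with the test function below.
\<close>

definition partial_fourier ::
  "((real \<times> real \<Rightarrow> complex) \<Rightarrow> complex) \<Rightarrow> int \<Rightarrow> ((real \<Rightarrow> complex) \<Rightarrow> complex)" where
  "partial_fourier u \<xi> =
     (\<lambda>\<psi>\<in>torus_smooth.
        1 / (2 * complex_of_real pi) *
        u (\<lambda>(t, x). \<psi> t * exp (- \<i> * complex_of_real x * of_int \<xi>)))"

section \<open>The operators\<close>

text \<open>\<open>\<partial>\<^sub>t - b(t) \<partial>\<^sub>x\<close> on functions and on distributions.\<close>

definition transport_fun ::
  "(real \<Rightarrow> real) \<Rightarrow> (real \<times> real \<Rightarrow> complex) \<Rightarrow> (real \<times> real \<Rightarrow> complex)" where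
  "transport_fun b f =
     (\<lambda>(t, x). dir_deriv (1, 0) f (t, x) - complex_of_real (b t) * dir_deriv (0, 1) f (t, x))"

definition transport_dist ::
  "(real \<Rightarrow> real) \<Rightarrow>
   ((real \<times> real \<Rightarrow> complex) \<Rightarrow> complex) \<Rightarrow> ((real \<times> real \<Rightarrow> complex) \<Rightarrow> complex)" where
  "transport_dist b u =
     (\<lambda>\<phi>\<in>torus_smooth.
        dist_deriv (1, 0) u \<phi> - dist_mult (\<lambda>(t, x). complex_of_real (b t)) (dist_deriv (0, 1) u) \<phi>)"

definition shear :: "(real \<Rightarrow> real) \<Rightarrow> real \<times> real \<Rightarrow> real \<times> real" where
  "shear B = (\<lambda>(t, x). (t, x - B t))"

definition Psi_fun ::
  "(real \<Rightarrow> real) \<Rightarrow> (real \<times> real \<Rightarrow> complex) \<Rightarrow> (real \<times> real \<Rightarrow> complex)" where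
  "Psi_fun B f = f \<circ> shear B"

definition Psi_dist ::
  "(real \<Rightarrow> real) \<Rightarrow>
   ((real \<times> real \<Rightarrow> complex) \<Rightarrow> complex) \<Rightarrow> ((real \<times> real \<Rightarrow> complex) \<Rightarrow> complex)" where
  "Psi_dist B = dist_pullback (shear B)"

section \<open>Automorphisms\<close>

text \<open>
  The elements of the spaces below are complex functions with domain of definition \<open>I\<close>:
  all points of the plane for \<open>C\<^sup>\<infinity>\<close>, all test functions for distributions. Linear combinations
  are formed pointwise on \<open>I\<close>.
\<close>

definition complex_linear_on ::
  "'i set \<Rightarrow> ('i \<Rightarrow> complex) set \<Rightarrow> (('i \<Rightarrow> complex) \<Rightarrow> ('i \<Rightarrow> complex)) \<Rightarrow> bool" where
  "complex_linear_on I S T \<longleftrightarrow>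
     (\<forall>f\<in>S. \<forall>g\<in>S. \<forall>c d.
        T (\<lambda>i\<in>I. c * f i + d * g i) = (\<lambda>i\<in>I. c * T f i + d * T g i))"

definition inverse_automorphisms ::
  "'i set \<Rightarrow> ('i \<Rightarrow> complex) topology \<Rightarrow>
   (('i \<Rightarrow> complex) \<Rightarrow> ('i \<Rightarrow> complex)) \<Rightarrow> (('i \<Rightarrow> complex) \<Rightarrow> ('i \<Rightarrow> complex)) \<Rightarrow> bool" where
  "inverse_automorphisms I X T T' \<longleftrightarrow>
     complex_linear_on I (topspace X) T \<and> complex_linear_on I (topspace X) T' \<and>
     homeomorphic_maps X X T T'"

end

theory Submission
  imports Defs
begin

text \<open>
  Everything reduces to test functions: the Jacobian of the shear is 1, so \<open>\<Psi>\<^sub>B\<close> on distributions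
  is the transpose of \<open>\<Psi>\<^sub>-\<^sub>B\<close> on smooth functions, and \<open>\<partial>\<^sub>t - b \<partial>\<^sub>x\<close>, with \<open>b\<close> depending on \<open>t\<close> only,
  is minus its own transpose. By the chain rule, \<open>\<Psi>\<^sub>B\<close> conjugates \<open>\<partial>\<^sub>t - b \<partial>\<^sub>x\<close> to
  \<open>\<partial>\<^sub>t - (b - B') \<partial>\<^sub>x\<close> and every seminorm of \<open>\<Psi>\<^sub>B f\<close> is bounded by finitely many seminorms of \<open>f\<close>.
  This makes \<open>\<Psi>\<^sub>B\<close> continuous on smooth functions and its transpose weakly continuous;
  since \<open>\<Psi>\<^sub>B\<close> also maps bounded sets to bounded sets, the transpose is strongly continuous.
\<close>

section \<open>Calculus of smooth functions\<close>

text \<open>Everything is proved for an arbitrary smooth periodic \<open>B\<close>; the two signs of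
  the theorem are the instances \<open>A\<close> and \<open>\<lambda>t. - A t\<close>, and passing
  from one to the other exchanges \<open>b\<close> and \<open>c\<close> in
  \<open>B' = b - c\<close>. The value of \<open>a0\<close> matters for one thing, the periodicity
  of \<open>A\<close>. The obstacle is that all seminorms are suprema in \<open>real\<close>, which
  mean something only for sets bounded above. Two facts make them usable: a smooth periodic function
  is bounded on its whole domain, by moving points into a compact period cell, and a distribution is
  bounded on each bounded set, by continuity at zero and rescaling. Higher derivatives of a sheared
  function involve products of derivatives of \<open>B\<close>, which are never written out. One
  derivative at a time is moved through the shear, at the price of a first order operator on
  \<open>f\<close>, and closure of \<open>dominated\<close> under precomposition with such operators
  absorbs it.\<close>

lemma dir_deriv_eqI: "(f has_derivative D) (at x) \<Longrightarrow> dir_deriv v f x = D v"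
  by (metis dir_deriv_def frechet_derivative_at)

lemma has_derivative_dir_deriv:
  "f differentiable (at x) \<Longrightarrow> (f has_derivative (\<lambda>v. dir_deriv v f x)) (at x)"
  by (simp add: dir_deriv_def frechet_derivative_works)

text \<open>Lets the caller supply the derivative as an explicit family \<open>D\<close>, so that
  the closure rules below can quote the sum, product and chain rules directly instead of computing
  with \<open>frechet_derivative\<close>.\<close>

lemma C_k_SucI:
  assumes "\<And>x. (f has_derivative D x) (at x)" and "\<And>v. C_k k (\<lambda>x. D x v)"
  shows "C_k (Suc k) f"
proof -
  have "dir_deriv v f = (\<lambda>x. D x v)" for v
    using assms(1) dir_deriv_eqI by blast
  then show ?thesis
    using assms by (auto simp: differentiable_def)
qed

lemma C_k_Suc_has_derivative:
  "C_k (Suc k) f \<Longrightarrow> (f has_derivative (\<lambda>v. dir_deriv v f x)) (at x)"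
  by (simp add: has_derivative_dir_deriv)

lemma C_k_SucD: "C_k (Suc k) f \<Longrightarrow> C_k k f"
proof (induction k arbitrary: f)
  case 0
  then show ?case
    by (auto intro!: continuous_at_imp_continuous_on differentiable_imp_continuous_within)
next
  case (Suc k)
  then show ?case
    by (metis C_k.simps(2))
qed

lemma C_k_const [simp]: "C_k k (\<lambda>x. c)"
proof (induction k arbitrary: c)
  case (Suc k)
  show ?case
    by (rule C_k_SucI[where D = "\<lambda>x v. 0"]) (auto simp: Suc)
qed simp

lemma C_k_add: "C_k k f \<Longrightarrow> C_k k g \<Longrightarrow> C_k k (\<lambda>x. f x + g x)"
proof (induction k arbitrary: f g)
  case 0
  then show ?case
    by (simp add: continuous_on_add)
next
  case (Suc k)
  show ?case
    by (rule C_k_SucI[OF has_derivative_add[OF Suc.prems[THEN C_k_Suc_has_derivative]]])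
      (use Suc in simp)
qed

lemma C_k_sum: "(\<And>i. i \<in> I \<Longrightarrow> C_k k (f i)) \<Longrightarrow> C_k k (\<lambda>x. \<Sum>i\<in>I. f i x)"
  by (induction I rule: infinite_finite_induct) (auto simp: C_k_add)

lemma C_k_bounded_linear:
  assumes "bounded_linear L" and "C_k k f"
  shows "C_k k (\<lambda>x. L (f x))"
  using assms(2)
proof (induction k arbitrary: f)
  case 0
  then show ?case
    using assms(1) by (simp add: bounded_linear.continuous_on)
next
  case (Suc k)
  show ?case
    by (rule C_k_SucI[OF bounded_linear.has_derivative
          [OF assms(1) Suc.prems[THEN C_k_Suc_has_derivative]]])
      (use Suc in simp)
qed

lemma C_k_ident: "C_k k (\<lambda>x. x)"
proof (cases k)
  case (Suc k')
  then show ?thesis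
    using C_k_SucI[of "\<lambda>x. x" "\<lambda>x v. v" k'] by simp
qed simp

text \<open>One Leibniz argument serves both complex multiplication and the scalar multiples that
  the chain rule produces.\<close>

lemma C_k_bilinear:
  assumes "bounded_bilinear mul"
  shows "C_k k f \<Longrightarrow> C_k k g \<Longrightarrow> C_k k (\<lambda>x. mul (f x) (g x))"
proof (induction k arbitrary: f g)
  case 0
  then show ?case
    using bounded_bilinear.continuous_on[OF assms] by simp
next
  case (Suc k)
  \<comment> \<open>Each Leibniz term keeps one factor undifferentiated, and the induction
    hypothesis asks for that factor at order \<open>k\<close>.\<close>
  have "C_k k f" "C_k k g"
    using Suc.prems C_k_SucD by blast+
  then show ?case
    by (intro C_k_SucI[OF bounded_bilinear.FDERIV
          [OF assms Suc.prems[THEN C_k_Suc_has_derivative]]] C_k_add Suc.IH)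
      (use Suc.prems in simp_all)
qed

lemmas C_k_mult = C_k_bilinear[OF bounded_bilinear_mult]

text \<open>In the usual chain rule the direction \<open>G' v\<close> in which \<open>f\<close> is
  differentiated moves with the point. Expanding it in the basis leaves derivatives of
  \<open>f\<close> in fixed directions, to which an induction on the order of smoothness
  applies.\<close>

lemma has_derivative_compose_basis:
  fixes G :: "'a::euclidean_space \<Rightarrow> 'b::euclidean_space"
  assumes f: "f differentiable (at (G x))" and G: "(G has_derivative G') (at x)"
  shows "((\<lambda>x. f (G x)) has_derivative (\<lambda>v. \<Sum>b\<in>Basis. (G' v \<bullet> b) *\<^sub>R dir_deriv b f (G x))) (at x)"
proof -
  have "linear (\<lambda>v. dir_deriv v f (G x))"
    using has_derivative_linear[OF has_derivative_dir_deriv[OF f]] .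
  then interpret linear "\<lambda>v. dir_deriv v f (G x)" .
  have "dir_deriv w f (G x) = (\<Sum>b\<in>Basis. (w \<bullet> b) *\<^sub>R dir_deriv b f (G x))" for w
    using sum[of "\<lambda>b. (w \<bullet> b) *\<^sub>R b" Basis] by (simp only: scale euclidean_representation)
  then have "(\<lambda>v. dir_deriv (G' v) f (G x)) =
      (\<lambda>v. \<Sum>b\<in>Basis. (G' v \<bullet> b) *\<^sub>R dir_deriv b f (G x))"
    by (rule ext)
  then show ?thesis
    using has_derivative_compose[OF G has_derivative_dir_deriv[OF f]] by (simp only:)
qed

lemma C_k_compose:
  fixes G :: "'a::euclidean_space \<Rightarrow> 'b::euclidean_space"
  shows "C_k k f \<Longrightarrow> C_k k G \<Longrightarrow> C_k k (\<lambda>x. f (G x))"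
proof (induction k arbitrary: f)
  case 0
  then show ?case
    using continuous_on_compose2[of UNIV f UNIV G] by simp
next
  case (Suc k)
  note G' = C_k_Suc_has_derivative[OF Suc.prems(2)]
  have "C_k k G"
    using Suc.prems(2) C_k_SucD by blast
  show ?case
  proof (rule C_k_SucI)
    show "((\<lambda>x. f (G x)) has_derivative
        (\<lambda>v. \<Sum>b\<in>Basis. (dir_deriv v G x \<bullet> b) *\<^sub>R dir_deriv b f (G x))) (at x)" for x
      using Suc.prems by (intro has_derivative_compose_basis G') simp_all
    show "C_k k (\<lambda>x. \<Sum>b\<in>Basis. (dir_deriv v G x \<bullet> b) *\<^sub>R dir_deriv b f (G x))" for v
    proof (intro C_k_sum C_k_bilinear[OF bounded_bilinear_scaleR])
      show "C_k k (\<lambda>x. dir_deriv v G x \<bullet> b)" for b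
        using Suc.prems by (intro C_k_bounded_linear[OF bounded_linear_inner_left]) simp
      show "C_k k (\<lambda>x. dir_deriv b f (G x))" for b
        using Suc.prems \<open>C_k k G\<close> by (intro Suc.IH) simp_all
    qed
  qed
qed

lemma C_k_exp: "C_k k (exp :: complex \<Rightarrow> complex)"
proof (induction k)
  case 0
  then show ?case
    by (simp add: continuous_on_exp)
next
  case (Suc k)
  show ?case
    by (rule C_k_SucI[OF DERIV_exp[unfolded has_field_derivative_def]])
      (rule C_k_mult[OF Suc C_k_const])
qed

section \<open>Smooth functions on the torus\<close>

lemma torus_smoothI:
  "(\<And>k. C_k k f) \<Longrightarrow> (\<And>x b. b \<in> Basis \<Longrightarrow> f (x + (2 * pi) *\<^sub>R b) = f x) \<Longrightarrow> f \<in> torus_smooth"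
  by (simp add: torus_smooth_def)

lemma torus_smooth_C_k: "f \<in> torus_smooth \<Longrightarrow> C_k k f"
  by (simp add: torus_smooth_def)

lemma torus_smooth_periodic:
  "f \<in> torus_smooth \<Longrightarrow> b \<in> Basis \<Longrightarrow> f (x + (2 * pi) *\<^sub>R b) = f x"
  by (simp add: torus_smooth_def)

lemma torus_smooth_has_derivative:
  "f \<in> torus_smooth \<Longrightarrow> (f has_derivative (\<lambda>v. dir_deriv v f x)) (at x)"
  using C_k_Suc_has_derivative torus_smooth_C_k by blast

lemma torus_smooth_continuous_on: "f \<in> torus_smooth \<Longrightarrow> continuous_on X f"
  using torus_smooth_C_k[of f 0] continuous_on_subset[of UNIV f X] by simp

lemma torus_smooth_const [simp]: "(\<lambda>x. c) \<in> torus_smooth"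
  by (simp add: torus_smooth_def)

lemma torus_smooth_mult:
  fixes f g :: "'a::euclidean_space \<Rightarrow> 'b::real_normed_algebra"
  shows "f \<in> torus_smooth \<Longrightarrow> g \<in> torus_smooth \<Longrightarrow> (\<lambda>x. f x * g x) \<in> torus_smooth"
  by (simp add: torus_smooth_def C_k_mult)

lemma torus_smooth_add:
  "f \<in> torus_smooth \<Longrightarrow> g \<in> torus_smooth \<Longrightarrow> (\<lambda>x. f x + g x) \<in> torus_smooth"
  by (simp add: torus_smooth_def C_k_add)

lemma torus_smooth_bounded_linear:
  "bounded_linear L \<Longrightarrow> f \<in> torus_smooth \<Longrightarrow> (\<lambda>x. L (f x)) \<in> torus_smooth"
  by (simp add: torus_smooth_def C_k_bounded_linear)

lemmas torus_smooth_of_real = torus_smooth_bounded_linear[OF bounded_linear_of_real]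

lemma torus_smooth_minus: "f \<in> torus_smooth \<Longrightarrow> (\<lambda>x. - f x) \<in> torus_smooth"
  by (rule torus_smooth_bounded_linear[OF bounded_linear_minus[OF bounded_linear_ident]])

lemma torus_smooth_fst:
  fixes f :: "'a::euclidean_space \<Rightarrow> 'c::real_normed_vector"
  assumes f: "f \<in> torus_smooth"
  shows "(\<lambda>x :: 'a \<times> 'b::euclidean_space. f (fst x)) \<in> torus_smooth"
proof (rule torus_smoothI)
  show "C_k k (\<lambda>x :: 'a \<times> 'b. f (fst x))" for k
    by (rule C_k_compose[OF torus_smooth_C_k[OF f] C_k_bounded_linear[OF bounded_linear_fst C_k_ident]])
  show "f (fst (x + (2 * pi) *\<^sub>R b)) = f (fst x)" if "b \<in> Basis" for x b :: "'a \<times> 'b"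
    using that torus_smooth_periodic[OF f] by (auto simp: Basis_prod_def)
qed

lemma torus_smooth_lincomb:
  fixes f g :: "'a::euclidean_space \<Rightarrow> complex"
  shows "f \<in> torus_smooth \<Longrightarrow> g \<in> torus_smooth \<Longrightarrow> (\<lambda>x. c * f x + d * g x) \<in> torus_smooth"
  by (intro torus_smooth_add torus_smooth_mult torus_smooth_const)

lemma torus_smooth_diff:
  "f \<in> torus_smooth \<Longrightarrow> g \<in> torus_smooth \<Longrightarrow> (\<lambda>x. f x - g x) \<in> torus_smooth"
  using torus_smooth_add[of f "\<lambda>x. - g x"] torus_smooth_minus[of g] by simp

lemma torus_smooth_dir_deriv:
  assumes f: "f \<in> torus_smooth"
  shows "dir_deriv v f \<in> torus_smooth"
proof (rule torus_smoothI)
  show "C_k k (dir_deriv v f)" for k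
    using torus_smooth_C_k[OF f, of "Suc k"] by simp
  fix x b :: 'a
  assume b: "b \<in> Basis"
  \<comment> \<open>The translate by a period is \<open>f\<close> itself, so uniqueness of the
    derivative at \<open>x\<close> compares the derivatives at the two points.\<close>
  have "((\<lambda>y. f (y + (2 * pi) *\<^sub>R b)) has_derivative (\<lambda>v. dir_deriv v f (x + (2 * pi) *\<^sub>R b))) (at x)"
    by (rule has_derivative_compose[OF _ torus_smooth_has_derivative[OF f],
          where f' = "\<lambda>v. v" and s = UNIV]) (auto intro!: derivative_eq_intros)
  then have "(f has_derivative (\<lambda>v. dir_deriv v f (x + (2 * pi) *\<^sub>R b))) (at x)"
    using torus_smooth_periodic[OF f b] by simp
  then show "dir_deriv v f (x + (2 * pi) *\<^sub>R b) = dir_deriv v f x"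
    by (simp add: dir_deriv_eqI)
qed

lemma torus_smooth_foldr_dir_deriv: "f \<in> torus_smooth \<Longrightarrow> foldr dir_deriv vs f \<in> torus_smooth"
  by (induction vs) (auto intro: torus_smooth_dir_deriv)

section \<open>Periodicity under the whole lattice, and boundedness\<close>

lemma torus_smooth_periodic_nat:
  assumes "f \<in> torus_smooth" "b \<in> Basis"
  shows "f (x + (2 * pi * of_nat n) *\<^sub>R b) = f x"
proof (induction n)
  case (Suc n)
  have "x + (2 * pi * of_nat (Suc n)) *\<^sub>R b = (x + (2 * pi * of_nat n) *\<^sub>R b) + (2 * pi) *\<^sub>R b"
    by (simp add: algebra_simps)
  then show ?case
    using torus_smooth_periodic[OF assms] Suc by metis
qed simp

lemma torus_smooth_periodic_int:
  assumes "f \<in> torus_smooth" "b \<in> Basis"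
  shows "f (x + (2 * pi * of_int n) *\<^sub>R b) = f x"
proof (cases n)
  case (nonneg m)
  then show ?thesis
    using torus_smooth_periodic_nat[OF assms] by simp
next
  case (neg m)
  have "(x + (2 * pi * of_int n) *\<^sub>R b) + (2 * pi * of_nat (Suc m)) *\<^sub>R b = x"
    unfolding neg add.assoc scaleR_add_left[symmetric] by (simp add: algebra_simps)
  then show ?thesis
    using torus_smooth_periodic_nat[OF assms, of "x + (2 * pi * of_int n) *\<^sub>R b" "Suc m"]
    by (simp only:)
qed

lemma torus_smooth_periodic_lattice:
  assumes "f \<in> torus_smooth" "F \<subseteq> Basis"
  shows "f (x + (\<Sum>b\<in>F. (2 * pi * of_int (n b)) *\<^sub>R b)) = f x"
proof -
  have "finite F"
    using assms(2) finite_Basis finite_subset by blast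
  then show ?thesis
    using assms(2)
  proof (induction F)
    case (insert b F)
    have "x + (\<Sum>b\<in>insert b F. (2 * pi * of_int (n b)) *\<^sub>R b) =
        (x + (\<Sum>b\<in>F. (2 * pi * of_int (n b)) *\<^sub>R b)) + (2 * pi * of_int (n b)) *\<^sub>R b"
      using insert.hyps by (simp add: algebra_simps)
    moreover have "b \<in> Basis" "F \<subseteq> Basis"
      using insert.prems by auto
    ultimately show ?case
      by (simp only: insert.IH torus_smooth_periodic_int[OF assms(1)])
  qed simp
qed

text \<open>Lattice translations carry every point into a compact cell, where continuity gives a
  bound. This is what makes the supremum in \<open>torus_seminorm\<close> an actual upper
  bound.\<close>

lemma torus_smooth_bounded:
  assumes f: "f \<in> torus_smooth"
  shows "bdd_above (range (\<lambda>x. norm (f x)))"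
proof -
  define K :: "'a set" where "K = cbox 0 ((2 * pi) *\<^sub>R One)"
  have "bounded (f ` K)"
    unfolding K_def by (intro compact_imp_bounded compact_continuous_image
        torus_smooth_continuous_on f compact_cbox)
  then obtain M where M: "\<And>y. y \<in> K \<Longrightarrow> norm (f y) \<le> M"
    by (auto simp: bounded_iff)
  have "norm (f x) \<le> M" for x
  proof -
    \<comment> \<open>Subtracting the integer part leaves \<open>2 * pi\<close> times a fractional
      part in each coordinate, which lies in the cell.\<close>
    define n where "n b = - \<lfloor>(x \<bullet> b) / (2 * pi)\<rfloor>" for b
    define y where "y = x + (\<Sum>b\<in>Basis. (2 * pi * of_int (n b)) *\<^sub>R b)"
    have y: "y \<bullet> b = x \<bullet> b + 2 * pi * of_int (n b)" if "b \<in> Basis" for b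
      using that by (simp add: y_def inner_add_left inner_sum_left_Basis)
    have "0 \<le> y \<bullet> b \<and> y \<bullet> b \<le> 2 * pi" if "b \<in> Basis" for b
    proof -
      have "y \<bullet> b = 2 * pi * frac ((x \<bullet> b) / (2 * pi))"
        unfolding y[OF that] by (simp add: n_def frac_def algebra_simps)
      then show ?thesis
        using frac_lt_1[of "(x \<bullet> b) / (2 * pi)"] by (simp add: less_imp_le)
    qed
    then have "y \<in> K"
      by (simp add: K_def mem_box)
    then show ?thesis
      using M torus_smooth_periodic_lattice[OF f, of Basis x n] by (fastforce simp: y_def)
  qed
  then show ?thesis
    by (intro bdd_aboveI2[of _ _ M])
qed

section \<open>The seminorms of smooth functions\<close>

lemma dir_deriv_lincomb:
  fixes f g :: "'a::euclidean_space \<Rightarrow> complex"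
  assumes "f \<in> torus_smooth" "g \<in> torus_smooth"
  shows "dir_deriv v (\<lambda>x. c * f x + d * g x) = (\<lambda>x. c * dir_deriv v f x + d * dir_deriv v g x)"
  by (intro ext dir_deriv_eqI)
    (auto intro!: derivative_eq_intros assms[THEN torus_smooth_has_derivative])

lemma dir_deriv_mult:
  fixes f g :: "'a::euclidean_space \<Rightarrow> complex"
  assumes "f \<in> torus_smooth" "g \<in> torus_smooth"
  shows "dir_deriv v (\<lambda>x. f x * g x) = (\<lambda>x. dir_deriv v f x * g x + f x * dir_deriv v g x)"
  by (intro ext dir_deriv_eqI)
    (auto intro!: derivative_eq_intros assms[THEN torus_smooth_has_derivative])

lemma foldr_dir_deriv_lincomb:
  fixes f g :: "'a::euclidean_space \<Rightarrow> complex"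
  assumes "f \<in> torus_smooth" "g \<in> torus_smooth"
  shows "foldr dir_deriv vs (\<lambda>x. c * f x + d * g x) =
    (\<lambda>x. c * foldr dir_deriv vs f x + d * foldr dir_deriv vs g x)"
  by (induction vs) (simp_all add: dir_deriv_lincomb assms torus_smooth_foldr_dir_deriv)

lemma torus_seminorm_upper:
  "f \<in> torus_smooth \<Longrightarrow> norm (foldr dir_deriv vs f x) \<le> torus_seminorm vs f"
  unfolding torus_seminorm_def
  by (intro cSUP_upper torus_smooth_bounded torus_smooth_foldr_dir_deriv UNIV_I)

lemma torus_seminorm_least:
  "(\<And>x. norm (foldr dir_deriv vs f x) \<le> M) \<Longrightarrow> torus_seminorm vs f \<le> M"
  unfolding torus_seminorm_def by (intro cSUP_least) auto

lemma torus_seminorm_lincomb: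
  assumes "f \<in> torus_smooth" "g \<in> torus_smooth"
  shows "torus_seminorm vs (\<lambda>x. c * f x + d * g x) \<le>
    norm c * torus_seminorm vs f + norm d * torus_seminorm vs g"
proof (rule torus_seminorm_least)
  fix x
  show "norm (foldr dir_deriv vs (\<lambda>x. c * f x + d * g x) x) \<le>
      norm c * torus_seminorm vs f + norm d * torus_seminorm vs g"
    unfolding foldr_dir_deriv_lincomb[OF assms]
    by (rule order_trans[OF norm_triangle_ineq])
      (auto simp: norm_mult intro!: add_mono mult_left_mono torus_seminorm_upper assms)
qed

lemma torus_seminorm_add:
  "f \<in> torus_smooth \<Longrightarrow> g \<in> torus_smooth \<Longrightarrow>
    torus_seminorm vs (\<lambda>x. f x + g x) \<le> torus_seminorm vs f + torus_seminorm vs g"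
  using torus_seminorm_lincomb[of f g vs 1 1] by simp

lemma torus_seminorm_scale:
  "f \<in> torus_smooth \<Longrightarrow> torus_seminorm vs (\<lambda>x. c * f x) \<le> norm c * torus_seminorm vs f"
  using torus_seminorm_lincomb[of f f vs c 0] by simp

lemma torus_seminorm_nonneg: "f \<in> torus_smooth \<Longrightarrow> 0 \<le> torus_seminorm vs f"
  using torus_seminorm_upper norm_ge_zero order_trans by blast

lemma torus_seminorm_zero [simp]: "torus_seminorm vs (\<lambda>x. 0) = 0"
  using torus_seminorm_scale[of "\<lambda>x. 0" vs 0] torus_seminorm_nonneg[of "\<lambda>x. 0" vs] by simp

text \<open>Equivalently, the functionals on smooth functions bounded by a multiple of a finite sum of
  seminorms. The inductive form avoids computing with such sums.\<close>

inductive dominated :: "(('a::euclidean_space \<Rightarrow> complex) \<Rightarrow> real) \<Rightarrow> bool" where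
  seminorm: "set vs \<subseteq> Basis \<Longrightarrow> dominated (torus_seminorm vs)"
| add: "dominated p \<Longrightarrow> dominated q \<Longrightarrow> dominated (\<lambda>f. p f + q f)"
| scale: "0 \<le> c \<Longrightarrow> dominated p \<Longrightarrow> dominated (\<lambda>f. c * p f)"
| mono: "dominated q \<Longrightarrow> (\<And>f. f \<in> torus_smooth \<Longrightarrow> p f \<le> q f) \<Longrightarrow> dominated p"

text \<open>Precomposition commutes with sums, multiples and pointwise bounds, so estimates for
  single seminorms extend to all dominated functionals. It replaces substituting one finite sum of
  seminorms into another.\<close>

lemma dominated_compose:
  assumes "dominated p" and "\<And>f. f \<in> torus_smooth \<Longrightarrow> T f \<in> torus_smooth"
    and "\<And>vs. set vs \<subseteq> Basis \<Longrightarrow> dominated (\<lambda>f. torus_seminorm vs (T f))"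
  shows "dominated (\<lambda>f. p (T f))"
  using assms(1)
proof induction
  case (mono q p)
  then show ?case
    using assms(2) by (auto intro: dominated.mono[of "\<lambda>f. q (T f)"])
qed (auto intro: assms(3) dominated.add dominated.scale)

lemma dominated_bdd_above:
  assumes "dominated p" and B: "torus_bounded B"
  shows "bdd_above (p ` B)"
  using assms(1)
proof induction
  case (seminorm vs)
  then show ?case
    using B by (simp add: torus_bounded_def)
next
  case (add p q)
  then obtain M N where "\<And>f. f \<in> B \<Longrightarrow> p f \<le> M" "\<And>f. f \<in> B \<Longrightarrow> q f \<le> N"
    by (auto simp: bdd_above_def)
  then show ?case
    by (auto intro!: bdd_aboveI2[of _ _ "M + N"] add_mono)
next
  case (scale c p)
  then obtain M where "\<And>f. f \<in> B \<Longrightarrow> p f \<le> M"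
    by (auto simp: bdd_above_def)
  then show ?case
    using scale by (auto intro!: bdd_aboveI2[of _ _ "c * M"] mult_left_mono)
next
  case (mono q p)
  then obtain M where "\<And>f. f \<in> B \<Longrightarrow> q f \<le> M"
    by (auto simp: bdd_above_def)
  moreover have "p f \<le> q f" if "f \<in> B" for f
    using mono B that by (auto simp: torus_bounded_def)
  ultimately show ?case
    by (auto intro!: bdd_aboveI2[of _ _ M] intro: order_trans)
qed

text \<open>Turns a bound into continuity at zero, with one radius for finitely many seminorms: the
  shape of neighbourhood used for \<open>seminorm_topology\<close>.\<close>

lemma dominated_small:
  assumes "dominated p" "0 < e"
  shows "\<exists>Q d. finite Q \<and> Q \<subseteq> {torus_seminorm vs | vs. set vs \<subseteq> Basis} \<and> 0 < d \<and>
    (\<forall>f\<in>torus_smooth. (\<forall>q\<in>Q. q f < d) \<longrightarrow> p f < e)"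
  using assms
proof (induction arbitrary: e)
  case (seminorm vs)
  then show ?case
    by (intro exI[of _ "{torus_seminorm vs}"] exI[of _ e]) auto
next
  case (add p q)
  obtain P c where P: "finite P" "P \<subseteq> {torus_seminorm vs | vs. set vs \<subseteq> Basis}" "0 < c"
    "\<forall>f\<in>torus_smooth. (\<forall>q\<in>P. q f < c) \<longrightarrow> p f < e / 2"
    using add.IH(1)[of "e / 2"] add.prems by auto
  obtain Q d where Q: "finite Q" "Q \<subseteq> {torus_seminorm vs | vs. set vs \<subseteq> Basis}" "0 < d"
    "\<forall>f\<in>torus_smooth. (\<forall>r\<in>Q. r f < d) \<longrightarrow> q f < e / 2"
    using add.IH(2)[of "e / 2"] add.prems by auto
  have "p f + q f < e" if "f \<in> torus_smooth" "\<forall>r\<in>P \<union> Q. r f < min c d" for f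
  proof -
    have "p f < e / 2" "q f < e / 2"
      using P(4) Q(4) that by auto
    then show ?thesis
      by linarith
  qed
  with P Q show ?case
    by (intro exI[of _ "P \<union> Q"] exI[of _ "min c d"]) auto
next
  case (scale c p)
  \<comment> \<open>Dividing by \<open>c + 1\<close> instead of \<open>c\<close> covers
    \<open>c = 0\<close> and keeps the final inequality strict.\<close>
  obtain P d where P: "finite P" "P \<subseteq> {torus_seminorm vs | vs. set vs \<subseteq> Basis}" "0 < d"
    "\<forall>f\<in>torus_smooth. (\<forall>q\<in>P. q f < d) \<longrightarrow> p f < e / (c + 1)"
    using scale.IH[of "e / (c + 1)"] scale.prems scale.hyps by auto
  have "c * p f < e" if "p f < e / (c + 1)" for f
  proof -
    have "c * p f \<le> c * (e / (c + 1))"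
      using that scale.hyps by (intro mult_left_mono) auto
    also have "\<dots> < e"
      using scale.hyps scale.prems by (simp add: field_simps)
    finally show ?thesis .
  qed
  with P show ?case
    by (intro exI[of _ P] exI[of _ d]) blast
next
  case (mono q p)
  obtain P d where P: "finite P" "P \<subseteq> {torus_seminorm vs | vs. set vs \<subseteq> Basis}" "0 < d"
    "\<forall>f\<in>torus_smooth. (\<forall>r\<in>P. r f < d) \<longrightarrow> q f < e"
    using mono.IH[OF mono.prems] by auto
  with mono.hyps show ?case
    by (intro exI[of _ P] exI[of _ d]) (fastforce intro: le_less_trans)
qed

text \<open>\<open>foldr\<close> applies the last vector of the list first, so a derivative taken
  before all others is appended at the end. For the same reason the inductions over lists of
  directions run from the end.\<close>

lemma dominated_dir_deriv:
  "v \<in> Basis \<Longrightarrow> set vs \<subseteq> Basis \<Longrightarrow> dominated (\<lambda>f. torus_seminorm vs (dir_deriv v f))"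
  using dominated.seminorm[of "vs @ [v]"] by (simp add: torus_seminorm_def[abs_def])

text \<open>Taking the innermost derivative splits the product by the Leibniz rule; the multiplier
  may become \<open>dir_deriv v m\<close>, so the induction has to range over all
  \<open>m\<close>.\<close>

lemma dominated_mult:
  "m \<in> torus_smooth \<Longrightarrow> set vs \<subseteq> Basis \<Longrightarrow> dominated (\<lambda>f. torus_seminorm vs (\<lambda>x. m x * f x))"
proof (induction vs arbitrary: m rule: rev_induct)
  case Nil
  have "torus_seminorm [] (\<lambda>x. m x * f x) \<le> torus_seminorm [] m * torus_seminorm [] f"
    if f: "f \<in> torus_smooth" for f
  proof (rule torus_seminorm_least)
    fix x
    show "norm (foldr dir_deriv [] (\<lambda>x. m x * f x) x) \<le> torus_seminorm [] m * torus_seminorm [] f"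
      using torus_seminorm_upper[OF Nil.prems(1), of "[]" x] torus_seminorm_upper[OF f, of "[]" x]
      by (simp add: norm_mult mult_mono')
  qed
  moreover have "dominated (\<lambda>f. torus_seminorm [] m * torus_seminorm [] f)"
    by (intro dominated.scale dominated.seminorm torus_seminorm_nonneg Nil.prems(1)) simp
  ultimately show ?case
    by (rule dominated.mono[rotated])
next
  case (snoc v vs)
  have v: "v \<in> Basis" and vs: "set vs \<subseteq> Basis"
    using snoc.prems by auto
  have "dominated (\<lambda>f. torus_seminorm vs (\<lambda>x. dir_deriv v m x * f x))"
    by (intro snoc.IH torus_smooth_dir_deriv snoc.prems vs)
  moreover have "dominated (\<lambda>f. torus_seminorm vs (\<lambda>x. m x * dir_deriv v f x))"
    using dominated_compose[OF snoc.IH[OF snoc.prems(1) vs] torus_smooth_dir_deriv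
        dominated_dir_deriv[OF v]] .
  ultimately show ?case
  proof (rule dominated.mono[OF dominated.add])
    fix f :: "'a \<Rightarrow> complex"
    assume f: "f \<in> torus_smooth"
    have "torus_seminorm (vs @ [v]) (\<lambda>x. m x * f x) =
        torus_seminorm vs (\<lambda>x. dir_deriv v m x * f x + m x * dir_deriv v f x)"
      using dir_deriv_mult[OF snoc.prems(1) f] by (simp add: torus_seminorm_def)
    also have "\<dots> \<le> torus_seminorm vs (\<lambda>x. dir_deriv v m x * f x) +
        torus_seminorm vs (\<lambda>x. m x * dir_deriv v f x)"
      by (intro torus_seminorm_add torus_smooth_mult torus_smooth_dir_deriv snoc.prems f)
    finally show "torus_seminorm (vs @ [v]) (\<lambda>x. m x * f x) \<le> \<dots>" .
  qed
qed

section \<open>Topologies given by seminorms\<close>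

text \<open>The triangle inequality is stated for differences of members of \<open>S\<close>: the
  pointwise difference of two extensional functionals is 0 off the test functions and need not be
  extensional, so it may leave \<open>torus_dist\<close>. Restricting it to \<open>S\<close> also
  makes room for suprema that are finite only there. Nonemptiness of \<open>P\<close> ensures that
  the generating balls cover \<open>S\<close>.\<close>

locale seminorm_family =
  fixes S :: "('i \<Rightarrow> complex) set" and P :: "(('i \<Rightarrow> complex) \<Rightarrow> real) set"
  assumes nonempty: "P \<noteq> {}"
    and zero: "p \<in> P \<Longrightarrow> p (\<lambda>i. 0) = 0"
    and triangle: "p \<in> P \<Longrightarrow> f \<in> S \<Longrightarrow> g \<in> S \<Longrightarrow> h \<in> S \<Longrightarrow>
      p (\<lambda>i. h i - f i) \<le> p (\<lambda>i. h i - g i) + p (\<lambda>i. g i - f i)"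
begin

lemma topspace_eq [simp]: "topspace (seminorm_topology S P) = S"
  unfolding seminorm_topology_def topology_generated_by_topspace
proof (intro equalityI Union_least subsetI)
  fix U f
  assume "U \<in> {{g \<in> S. p (\<lambda>i. g i - f i) < e} | f p e. f \<in> S \<and> p \<in> P \<and> 0 < e}" and f: "f \<in> U"
  from this(1) obtain f' p e where "U = {g \<in> S. p (\<lambda>i. g i - f' i) < e}" "f' \<in> S" "p \<in> P"
    by (elim CollectE exE conjE) (rule that)
  with f show "f \<in> S"
    by (simp only: mem_Collect_eq)
next
  fix f
  assume f: "f \<in> S"
  obtain p where p: "p \<in> P"
    using nonempty by (meson ex_in_conv)
  show "f \<in> \<Union>{{g \<in> S. p (\<lambda>i. g i - f i) < e} | f p e. f \<in> S \<and> p \<in> P \<and> 0 < e}"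
  proof (rule UnionI)
    show "{g \<in> S. p (\<lambda>i. g i - f i) < 1} \<in>
        {{g \<in> S. p (\<lambda>i. g i - f i) < e} | f p e. f \<in> S \<and> p \<in> P \<and> 0 < e}"
      by (intro CollectI exI[of _ f] exI[of _ p] exI[of _ 1] conjI refl f p zero_less_one)
    show "f \<in> {g \<in> S. p (\<lambda>i. g i - f i) < 1}"
      using f zero[OF p] by simp
  qed
qed

lemma openin_ball:
  "f \<in> S \<Longrightarrow> p \<in> P \<Longrightarrow> 0 < e \<Longrightarrow> openin (seminorm_topology S P) {g \<in> S. p (\<lambda>i. g i - f i) < e}"
  unfolding seminorm_topology_def
  by (intro topology_generated_by_Basis CollectI exI[of _ f] exI[of _ p] exI[of _ e] conjI refl)

lemma openin_finite_ball:
  assumes "finite Q" "Q \<subseteq> P" "f \<in> S" "0 < e"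
  shows "openin (seminorm_topology S P) {g \<in> S. \<forall>q\<in>Q. q (\<lambda>i. g i - f i) < e}"
  using assms(1,2)
proof (induction Q)
  case empty
  show ?case
    using openin_topspace[of "seminorm_topology S P"] by simp
next
  case (insert p Q)
  have "{g \<in> S. \<forall>q\<in>insert p Q. q (\<lambda>i. g i - f i) < e} =
      {g \<in> S. p (\<lambda>i. g i - f i) < e} \<inter> {g \<in> S. \<forall>q\<in>Q. q (\<lambda>i. g i - f i) < e}"
    by auto
  moreover have "openin (seminorm_topology S P) {g \<in> S. p (\<lambda>i. g i - f i) < e}"
    using insert.prems assms(3,4) by (intro openin_ball) simp_all
  ultimately show ?case
    using insert by (simp only: openin_Int insert_subset)
qed

lemma openinI:
  assumes "U \<subseteq> S" and "\<And>f. f \<in> U \<Longrightarrow> \<exists>Q e. finite Q \<and> Q \<subseteq> P \<and> 0 < e \<and>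
    {g \<in> S. \<forall>q\<in>Q. q (\<lambda>i. g i - f i) < e} \<subseteq> U"
  shows "openin (seminorm_topology S P) U"
proof (subst openin_subopen, rule ballI)
  fix f
  assume f: "f \<in> U"
  obtain Q e where Q: "finite Q" "Q \<subseteq> P" "0 < e"
    and sub: "{g \<in> S. \<forall>q\<in>Q. q (\<lambda>i. g i - f i) < e} \<subseteq> U"
    using assms(2)[OF f] by (elim exE conjE)
  have fS: "f \<in> S"
    using f assms(1) by (rule rev_subsetD)
  have "q (\<lambda>i. f i - f i) < e" if "q \<in> Q" for q
    using zero[OF subsetD[OF Q(2) that]] Q(3) by simp
  then have "f \<in> {g \<in> S. \<forall>q\<in>Q. q (\<lambda>i. g i - f i) < e}"
    using fS by simp
  with openin_finite_ball[OF Q(1,2) fS Q(3)] sub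
  show "\<exists>T. openin (seminorm_topology S P) T \<and> f \<in> T \<and> T \<subseteq> U"
    by (intro exI conjI)
qed

text \<open>The generating balls may be centred anywhere. By the triangle inequality such a ball
  contains a ball around each of its points, whose radius is the distance left to the boundary;
  finite intersections combine the seminorms and take the smaller radius.\<close>

lemma openinD:
  assumes "openin (seminorm_topology S P) U" "f \<in> U"
  shows "\<exists>Q e. finite Q \<and> Q \<subseteq> P \<and> 0 < e \<and> {g \<in> S. \<forall>q\<in>Q. q (\<lambda>i. g i - f i) < e} \<subseteq> U"
  using openin_topology_generated_by[OF assms(1)[unfolded seminorm_topology_def]] assms(2)
proof (induction)
  case Empty
  then show ?case
    by simp
next
  case (Int U V)
  obtain Q c where Q: "finite Q" "Q \<subseteq> P" "0 < c" "{g \<in> S. \<forall>q\<in>Q. q (\<lambda>i. g i - f i) < c} \<subseteq> U"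
    using Int by blast
  obtain R d where R: "finite R" "R \<subseteq> P" "0 < d" "{g \<in> S. \<forall>q\<in>R. q (\<lambda>i. g i - f i) < d} \<subseteq> V"
    using Int by blast
  have "{g \<in> S. \<forall>q\<in>Q \<union> R. q (\<lambda>i. g i - f i) < min c d} \<subseteq> U \<inter> V"
    using Q(4) R(4) by auto
  with Q R show ?case
    by (intro exI[of _ "Q \<union> R"] exI[of _ "min c d"]) auto
next
  case (UN K)
  then obtain U where "U \<in> K" "f \<in> U"
    by blast
  with UN.IH[of U] show ?case
    by blast
next
  case (Basis U)
  from Basis.hyps obtain f' p e
    where U: "U = {g \<in> S. p (\<lambda>i. g i - f' i) < e}" and f': "f' \<in> S" and p: "p \<in> P"
    by (elim CollectE exE conjE) (rule that)
  have f: "f \<in> S" "0 < e - p (\<lambda>i. f i - f' i)"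
    using Basis.prems by (simp_all add: U)
  have "p (\<lambda>i. g i - f' i) < e" if "g \<in> S" "p (\<lambda>i. g i - f i) < e - p (\<lambda>i. f i - f' i)" for g
    using triangle[OF p f' f(1) that(1)] that(2) by simp
  with p f(2) show ?case
    by (intro exI[of _ "{p}"] exI[of _ "e - p (\<lambda>i. f i - f' i)"]) (simp add: U subset_eq)
qed

end

text \<open>It suffices to pull back generating balls, and recentring a ball at \<open>T f\<close>
  reduces this to the epsilon-delta condition at \<open>f\<close>.\<close>

lemma seminorm_topology_continuous_map:
  assumes "seminorm_family S P" and "seminorm_family S' P'"
    and maps: "\<And>f. f \<in> S \<Longrightarrow> T f \<in> S'"
    and cont: "\<And>p f e. p \<in> P' \<Longrightarrow> f \<in> S \<Longrightarrow> 0 < e \<Longrightarrow> \<exists>Q d. finite Q \<and> Q \<subseteq> P \<and> 0 < d \<and>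
      (\<forall>g\<in>S. (\<forall>q\<in>Q. q (\<lambda>i. g i - f i) < d) \<longrightarrow> p (\<lambda>i. T g i - T f i) < e)"
  shows "continuous_map (seminorm_topology S P) (seminorm_topology S' P') T"
proof -
  interpret dom: seminorm_family S P by fact
  interpret cod: seminorm_family S' P' by fact
  have "openin (seminorm_topology S P) {f \<in> S. p (\<lambda>i. T f i - f' i) < e}"
    if p: "p \<in> P'" and f': "f' \<in> S'" for p f' e
  proof (rule dom.openinI)
    fix f
    assume f: "f \<in> {f \<in> S. p (\<lambda>i. T f i - f' i) < e}"
    define d where "d = e - p (\<lambda>i. T f i - f' i)"
    have d: "0 < d" and fS: "f \<in> S"
      using f by (simp_all add: d_def)
    have "p (\<lambda>i. T g i - f' i) < e" if "g \<in> S" "p (\<lambda>i. T g i - T f i) < d" for g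
      using cod.triangle[OF p f' maps[OF fS] maps[OF that(1)]] that(2) by (simp add: d_def)
    with cont[OF p fS d]
    show "\<exists>Q d. finite Q \<and> Q \<subseteq> P \<and> 0 < d \<and>
        {g \<in> S. \<forall>q\<in>Q. q (\<lambda>i. g i - f i) < d} \<subseteq> {f \<in> S. p (\<lambda>i. T f i - f' i) < e}"
      by blast
  qed simp
  note preimage = this
  show ?thesis
    unfolding seminorm_topology_def[of S' P']
  proof (rule continuous_on_generated_topo)
    fix U
    assume "U \<in> {{g \<in> S'. p (\<lambda>i. g i - f i) < e} | f p e. f \<in> S' \<and> p \<in> P' \<and> 0 < e}"
    then obtain f' p e where U: "U = {g \<in> S'. p (\<lambda>i. g i - f' i) < e}" and "f' \<in> S'" "p \<in> P'"
      by (elim CollectE exE conjE) (rule that)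
    have "T -` U \<inter> topspace (seminorm_topology S P) = {f \<in> S. p (\<lambda>i. T f i - f' i) < e}"
      using maps by (auto simp: U)
    with preimage[OF \<open>p \<in> P'\<close> \<open>f' \<in> S'\<close>]
    show "openin (seminorm_topology S P) (T -` U \<inter> topspace (seminorm_topology S P))"
      by (simp only:)
  next
    show "T ` topspace (seminorm_topology S P) \<subseteq>
        \<Union>{{g \<in> S'. p (\<lambda>i. g i - f i) < e} | f p e. f \<in> S' \<and> p \<in> P' \<and> 0 < e}"
      using image_subsetI[of S T S', OF maps]
        cod.topspace_eq[unfolded seminorm_topology_def topology_generated_by_topspace]
      by (simp only: dom.topspace_eq)
  qed
qed

section \<open>The topologies of smooth functions and of distributions\<close>

interpretation torus_smooth: seminorm_family "torus_smooth :: ('a::euclidean_space \<Rightarrow> complex) set"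
  "{torus_seminorm vs | vs. set vs \<subseteq> Basis}"
proof
  show "{torus_seminorm vs :: ('a \<Rightarrow> complex) \<Rightarrow> real | vs. set vs \<subseteq> Basis} \<noteq> {}"
    by (rule ex_in_conv[THEN iffD1, OF exI[of _ "torus_seminorm []"]])
      (intro CollectI exI[of _ "[]"], simp)
  fix p :: "('a \<Rightarrow> complex) \<Rightarrow> real"
  assume "p \<in> {torus_seminorm vs | vs. set vs \<subseteq> Basis}"
  then obtain vs where p: "p = torus_seminorm vs" and "set vs \<subseteq> Basis"
    by (elim CollectE exE conjE) (rule that)
  show "p (\<lambda>i. 0) = 0"
    by (simp add: p)
  fix f g h :: "'a \<Rightarrow> complex"
  assume "f \<in> torus_smooth" "g \<in> torus_smooth" "h \<in> torus_smooth"
  then show "p (\<lambda>i. h i - f i) \<le> p (\<lambda>i. h i - g i) + p (\<lambda>i. g i - f i)"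
    using torus_seminorm_add[of "\<lambda>i. h i - g i" "\<lambda>i. g i - f i" vs]
    by (simp add: p torus_smooth_diff)
qed

lemma topspace_torus_smooth [simp]: "topspace torus_smooth_topology = torus_smooth"
  by (simp add: torus_smooth_topology_def)

text \<open>Compatibility with differences moves the estimate from an arbitrary point to the zero
  function, where \<open>dominated_small\<close> applies.\<close>

lemma torus_smooth_continuous_map:
  fixes T :: "('a::euclidean_space \<Rightarrow> complex) \<Rightarrow> ('b::euclidean_space \<Rightarrow> complex)"
  assumes maps: "\<And>f. f \<in> torus_smooth \<Longrightarrow> T f \<in> torus_smooth"
    and diff: "\<And>f g. f \<in> torus_smooth \<Longrightarrow> g \<in> torus_smooth \<Longrightarrow>
      (\<lambda>x. T g x - T f x) = T (\<lambda>x. g x - f x)"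
    and dom: "\<And>vs. set vs \<subseteq> Basis \<Longrightarrow> dominated (\<lambda>f. torus_seminorm vs (T f))"
  shows "continuous_map torus_smooth_topology torus_smooth_topology T"
  unfolding torus_smooth_topology_def
proof (rule seminorm_topology_continuous_map[OF torus_smooth.seminorm_family_axioms
      torus_smooth.seminorm_family_axioms maps])
  fix p :: "('b \<Rightarrow> complex) \<Rightarrow> real" and f :: "'a \<Rightarrow> complex" and e :: real
  assume p: "p \<in> {torus_seminorm vs | vs. set vs \<subseteq> Basis}" and f: "f \<in> torus_smooth" and e: "0 < e"
  from p obtain vs where p: "p = torus_seminorm vs" and vs: "set vs \<subseteq> Basis"
    by (elim CollectE exE conjE) (rule that)
  from dominated_small[OF dom[OF vs] e] obtain Q d
    where Q: "finite Q" "Q \<subseteq> {torus_seminorm vs | vs. set vs \<subseteq> Basis}" "0 < d"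
      and small: "\<forall>g\<in>torus_smooth. (\<forall>q\<in>Q. q g < d) \<longrightarrow> torus_seminorm vs (T g) < e"
    by (elim exE conjE) (rule that)
  have "p (\<lambda>i. T g i - T f i) < e"
    if "g \<in> torus_smooth" "\<forall>q\<in>Q. q (\<lambda>i. g i - f i) < d" for g
    using small[rule_format, OF torus_smooth_diff[OF that(1) f]] that(2) diff[OF f that(1)]
    by (simp add: p)
  then show "\<exists>Q d. finite Q \<and> Q \<subseteq> {torus_seminorm vs | vs. set vs \<subseteq> Basis} \<and> 0 < d \<and>
      (\<forall>g\<in>torus_smooth. (\<forall>q\<in>Q. q (\<lambda>i. g i - f i) < d) \<longrightarrow> p (\<lambda>i. T g i - T f i) < e)"
    by (intro exI[of _ Q] exI[of _ d] conjI ballI impI Q)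
qed

section \<open>Distributions and bounded sets of test functions\<close>

lemma torus_dist_lincomb:
  "u \<in> torus_dist \<Longrightarrow> \<phi> \<in> torus_smooth \<Longrightarrow> \<psi> \<in> torus_smooth \<Longrightarrow>
    u (\<lambda>x. c * \<phi> x + d * \<psi> x) = c * u \<phi> + d * u \<psi>"
  by (simp add: torus_dist_def)

lemma torus_dist_zero: "u \<in> torus_dist \<Longrightarrow> u (\<lambda>x. 0) = 0"
  using torus_dist_lincomb[of u "\<lambda>x. 0" "\<lambda>x. 0" 0 0] by simp

lemma torus_dist_scale: "u \<in> torus_dist \<Longrightarrow> \<phi> \<in> torus_smooth \<Longrightarrow> u (\<lambda>x. c * \<phi> x) = c * u \<phi>"
  using torus_dist_lincomb[of u \<phi> \<phi> c 0] by simp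

text \<open>The common bound is required to be positive because it becomes a divisor when a bounded
  set is shrunk into a neighbourhood of zero.\<close>

lemma torus_bounded_uniform:
  assumes B: "torus_bounded B" and "finite Q" "Q \<subseteq> {torus_seminorm vs | vs. set vs \<subseteq> Basis}"
  shows "\<exists>M>0. \<forall>q\<in>Q. \<forall>\<phi>\<in>B. q \<phi> \<le> M"
  using assms(2,3)
proof (induction Q)
  case (insert p Q)
  then obtain M where M: "0 < M" "\<forall>q\<in>Q. \<forall>\<phi>\<in>B. q \<phi> \<le> M"
    by auto
  have "bdd_above (p ` B)"
    using insert.prems B by (auto simp: torus_bounded_def)
  then obtain N where "\<And>\<phi>. \<phi> \<in> B \<Longrightarrow> p \<phi> \<le> N"
    by (auto simp: bdd_above_def)
  with M show ?case
    by (intro exI[of _ "max M N"]) (auto simp: le_max_iff_disj)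
qed (auto intro: exI[of _ 1])

text \<open>Continuity bounds \<open>u\<close> by 1 on a neighbourhood of zero; a fixed positive
  multiple of \<open>B\<close> lies inside it, and linearity scales the bound back.\<close>

lemma torus_dist_bounded:
  assumes u: "u \<in> torus_dist" and B: "torus_bounded B"
  shows "bdd_above ((\<lambda>\<phi>. norm (u \<phi>)) ` B)"
proof -
  have "continuous_map torus_smooth_topology euclidean u"
    using u by (simp add: torus_dist_def)
  then have op: "openin torus_smooth_topology {\<phi> \<in> torus_smooth. u \<phi> \<in> ball 0 1}"
    using openin_continuous_map_preimage[of torus_smooth_topology euclidean u "ball 0 1"] by simp
  have zero: "(\<lambda>x. 0) \<in> {\<phi> \<in> torus_smooth. u \<phi> \<in> ball 0 1}"
    by (simp add: torus_dist_zero[OF u])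
  from torus_smooth.openinD[OF op[unfolded torus_smooth_topology_def] zero]
  obtain Q d where Q: "finite Q" "Q \<subseteq> {torus_seminorm vs | vs. set vs \<subseteq> Basis}" "0 < d"
    and sub: "{g \<in> torus_smooth. \<forall>q\<in>Q. q (\<lambda>i. g i - 0) < d} \<subseteq> {\<phi> \<in> torus_smooth. u \<phi> \<in> ball 0 1}"
    by (elim exE conjE) (rule that)
  have small: "norm (u \<phi>) < 1" if "\<phi> \<in> torus_smooth" "\<forall>q\<in>Q. q \<phi> < d" for \<phi>
    using subsetD[OF sub, of \<phi>] that by simp
  obtain M where M: "0 < M" "\<And>q \<phi>. q \<in> Q \<Longrightarrow> \<phi> \<in> B \<Longrightarrow> q \<phi> \<le> M"
    using torus_bounded_uniform[OF B Q(1,2)] by blast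
  \<comment> \<open>Then \<open>s * M\<close> is \<open>d / 2\<close>, strictly inside the
    neighbourhood of radius \<open>d\<close>.\<close>
  define s where "s = d / (2 * M)"
  have s: "0 < s" "s * M < d"
    using Q(3) M(1) by (simp_all add: s_def)
  have "norm (u \<phi>) \<le> 1 / s" if \<phi>: "\<phi> \<in> B" for \<phi>
  proof -
    have \<phi>s: "\<phi> \<in> torus_smooth"
      using B \<phi> by (auto simp: torus_bounded_def)
    have "q (\<lambda>x. complex_of_real s * \<phi> x) < d" if q: "q \<in> Q" for q
    proof -
      obtain vs where vs: "q = torus_seminorm vs" and "set vs \<subseteq> Basis"
        using subsetD[OF Q(2) q] by (elim CollectE exE conjE) (rule that)
      have "q (\<lambda>x. complex_of_real s * \<phi> x) \<le> s * q \<phi>"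
        using torus_seminorm_scale[OF \<phi>s, of vs "complex_of_real s"] s(1) by (simp add: vs)
      also have "\<dots> \<le> s * M"
        using M(2)[OF q \<phi>] s(1) by simp
      finally show ?thesis
        using s(2) by simp
    qed
    moreover have "(\<lambda>x. complex_of_real s * \<phi> x) \<in> torus_smooth"
      by (intro torus_smooth_mult torus_smooth_const \<phi>s)
    ultimately have "norm (u (\<lambda>x. complex_of_real s * \<phi> x)) < 1"
      using small by blast
    then show ?thesis
      using s(1) by (simp add: torus_dist_scale[OF u \<phi>s] norm_mult field_simps)
  qed
  then show ?thesis
    by (intro bdd_aboveI2[of _ _ "1 / s"])
qed

interpretation weak: seminorm_family "torus_dist :: (('a::euclidean_space \<Rightarrow> complex) \<Rightarrow> complex) set"
  "{(\<lambda>u. norm (u \<phi>)) | \<phi>. \<phi> \<in> torus_smooth}"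
proof
  show "{(\<lambda>u. norm (u \<phi>)) | \<phi> :: 'a \<Rightarrow> complex. \<phi> \<in> torus_smooth} \<noteq> ({} :: ((('a \<Rightarrow> complex) \<Rightarrow> complex) \<Rightarrow> real) set)"
    by (rule ex_in_conv[THEN iffD1, OF exI[of _ "\<lambda>u. norm (u (\<lambda>x. 0))"]])
      (intro CollectI exI[of _ "\<lambda>x. 0"], simp)
  fix p :: "(('a \<Rightarrow> complex) \<Rightarrow> complex) \<Rightarrow> real"
  assume "p \<in> {(\<lambda>u. norm (u \<phi>)) | \<phi>. \<phi> \<in> torus_smooth}"
  then obtain \<phi> where p: "p = (\<lambda>u. norm (u \<phi>))" and "\<phi> \<in> torus_smooth"
    by (elim CollectE exE conjE) (rule that)
  show "p (\<lambda>i. 0) = 0"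
    by (simp add: p)
  show "p (\<lambda>i. h i - f i) \<le> p (\<lambda>i. h i - g i) + p (\<lambda>i. g i - f i)"
    for f g h :: "('a \<Rightarrow> complex) \<Rightarrow> complex"
    using norm_triangle_ineq[of "h \<phi> - g \<phi>" "g \<phi> - f \<phi>"] by (simp add: p)
qed

text \<open>Supplies the upper bounds that the triangle inequality for the strong seminorms needs,
  for the difference itself, since it need not be a member of \<open>torus_dist\<close>.\<close>

lemma torus_dist_diff_bounded:
  assumes "u \<in> torus_dist" "w \<in> torus_dist" "torus_bounded B"
  shows "bdd_above ((\<lambda>\<phi>. norm (u \<phi> - w \<phi>)) ` B)"
proof -
  obtain M N where "\<And>\<phi>. \<phi> \<in> B \<Longrightarrow> norm (u \<phi>) \<le> M" "\<And>\<phi>. \<phi> \<in> B \<Longrightarrow> norm (w \<phi>) \<le> N"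
    using assms(1,2)[THEN torus_dist_bounded, OF assms(3)] by (auto simp: bdd_above_def)
  then have "norm (u \<phi> - w \<phi>) \<le> M + N" if "\<phi> \<in> B" for \<phi>
    using that norm_triangle_ineq4[of "u \<phi>" "w \<phi>"] by (smt (verit))
  then show ?thesis
    by (intro bdd_aboveI2[of _ _ "M + N"])
qed

interpretation strong: seminorm_family "torus_dist :: (('a::euclidean_space \<Rightarrow> complex) \<Rightarrow> complex) set"
  "{(\<lambda>u. SUP \<phi>\<in>B. norm (u \<phi>)) | B. B \<noteq> {} \<and> torus_bounded B}"
proof
  have "torus_bounded {\<lambda>x :: 'a. 0}"
    by (simp add: torus_bounded_def)
  then have "(\<lambda>u. SUP \<phi>\<in>{\<lambda>x :: 'a. 0}. norm (u \<phi>)) \<in>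
      {(\<lambda>u. SUP \<phi>\<in>B. norm (u \<phi>)) | B. B \<noteq> {} \<and> torus_bounded B}"
    by (intro CollectI exI[of _ "{\<lambda>x. 0}"] conjI refl) simp
  then show "{(\<lambda>u. SUP \<phi>\<in>B. norm (u \<phi>)) | B :: ('a \<Rightarrow> complex) set. B \<noteq> {} \<and> torus_bounded B} \<noteq>
      ({} :: ((('a \<Rightarrow> complex) \<Rightarrow> complex) \<Rightarrow> real) set)"
    by (rule ex_in_conv[THEN iffD1, OF exI])
  fix p :: "(('a \<Rightarrow> complex) \<Rightarrow> complex) \<Rightarrow> real"
  assume "p \<in> {(\<lambda>u. SUP \<phi>\<in>B. norm (u \<phi>)) | B. B \<noteq> {} \<and> torus_bounded B}"
  then obtain B where p: "p = (\<lambda>u. SUP \<phi>\<in>B. norm (u \<phi>))" and B: "B \<noteq> {}" "torus_bounded B"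
    by (elim CollectE exE conjE) (rule that)
  show "p (\<lambda>i. 0) = 0"
    using B by (simp add: p)
  fix f g h :: "('a \<Rightarrow> complex) \<Rightarrow> complex"
  assume f: "f \<in> torus_dist" and g: "g \<in> torus_dist" and h: "h \<in> torus_dist"
  show "p (\<lambda>i. h i - f i) \<le> p (\<lambda>i. h i - g i) + p (\<lambda>i. g i - f i)"
    unfolding p
  proof (rule cSUP_least[OF B(1)])
    fix \<phi>
    assume \<phi>: "\<phi> \<in> B"
    have "norm (h \<phi> - f \<phi>) \<le> norm (h \<phi> - g \<phi>) + norm (g \<phi> - f \<phi>)"
      using norm_triangle_ineq[of "h \<phi> - g \<phi>" "g \<phi> - f \<phi>"] by simp
    also have "\<dots> \<le> (SUP \<phi>\<in>B. norm (h \<phi> - g \<phi>)) + (SUP \<phi>\<in>B. norm (g \<phi> - f \<phi>))"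
      by (intro add_mono cSUP_upper \<phi> torus_dist_diff_bounded f g h B)
    finally show "norm (h \<phi> - f \<phi>) \<le> \<dots>" .
  qed
qed

lemma topspace_weak_dist [simp]: "topspace weak_dist_topology = torus_dist"
  by (simp add: weak_dist_topology_def)

lemma topspace_strong_dist [simp]: "topspace strong_dist_topology = torus_dist"
  by (simp add: strong_dist_topology_def)

section \<open>Transposes of operators on test functions\<close>

lemma torus_dist_transpose:
  fixes T :: "('a::euclidean_space \<Rightarrow> complex) \<Rightarrow> ('b::euclidean_space \<Rightarrow> complex)"
  assumes T: "continuous_map torus_smooth_topology torus_smooth_topology T"
    and lin: "\<And>f g c d. T (\<lambda>x. c * f x + d * g x) = (\<lambda>x. c * T f x + d * T g x)"
    and u: "u \<in> torus_dist"
  shows "(\<lambda>\<phi>\<in>torus_smooth. u (T \<phi>)) \<in> torus_dist"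
proof -
  have maps: "T f \<in> torus_smooth" if "f \<in> torus_smooth" for f
    using continuous_map_image_subset_topspace[OF T] that by auto
  have "continuous_map torus_smooth_topology euclidean (u \<circ> T)"
    using u T by (auto simp: torus_dist_def intro: continuous_map_compose)
  then have "continuous_map torus_smooth_topology euclidean (\<lambda>\<phi>\<in>torus_smooth. u (T \<phi>))"
    by (rule continuous_map_eq) simp
  then show ?thesis
    using maps u by (simp add: torus_dist_def lin torus_smooth_lincomb)
qed

text \<open>The seminorm at \<open>\<phi>\<close> of a transposed distribution is the seminorm at
  \<open>T \<phi>\<close> of the original one, so one seminorm and the same radius suffice.\<close>

lemma transpose_weak_continuous:
  fixes T :: "('a::euclidean_space \<Rightarrow> complex) \<Rightarrow> ('b::euclidean_space \<Rightarrow> complex)"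
  assumes T: "\<And>f. f \<in> torus_smooth \<Longrightarrow> T f \<in> torus_smooth"
    and maps: "\<And>u. u \<in> torus_dist \<Longrightarrow> (\<lambda>\<phi>\<in>torus_smooth. u (T \<phi>)) \<in> torus_dist"
  shows "continuous_map weak_dist_topology weak_dist_topology (\<lambda>u. \<lambda>\<phi>\<in>torus_smooth. u (T \<phi>))"
  unfolding weak_dist_topology_def
proof (rule seminorm_topology_continuous_map[OF weak.seminorm_family_axioms
      weak.seminorm_family_axioms maps])
  fix p :: "(('a \<Rightarrow> complex) \<Rightarrow> complex) \<Rightarrow> real" and u :: "('b \<Rightarrow> complex) \<Rightarrow> complex" and e :: real
  assume "p \<in> {(\<lambda>u. norm (u \<phi>)) | \<phi>. \<phi> \<in> torus_smooth}" and e: "0 < e"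
  from this(1) obtain \<phi> where p: "p = (\<lambda>u. norm (u \<phi>))" and \<phi>: "\<phi> \<in> torus_smooth"
    by (elim CollectE exE conjE) (rule that)
  have "(\<lambda>u. norm (u (T \<phi>))) \<in> {(\<lambda>u. norm (u \<phi>)) | \<phi>. \<phi> \<in> torus_smooth}"
    by (intro CollectI exI[of _ "T \<phi>"] conjI refl T \<phi>)
  with \<phi> e show "\<exists>Q d. finite Q \<and> Q \<subseteq> {(\<lambda>u. norm (u \<phi>)) | \<phi>. \<phi> \<in> torus_smooth} \<and> 0 < d \<and>
      (\<forall>w\<in>torus_dist. (\<forall>q\<in>Q. q (\<lambda>i. w i - u i) < d) \<longrightarrow>
        p (\<lambda>i. (\<lambda>\<phi>\<in>torus_smooth. w (T \<phi>)) i - (\<lambda>\<phi>\<in>torus_smooth. u (T \<phi>)) i) < e)"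
    by (intro exI[of _ "{\<lambda>u. norm (u (T \<phi>))}"] exI[of _ e] conjI) (simp_all add: p)
qed

text \<open>The seminorm for \<open>B\<close> pulls back to the seminorm for the image of
  \<open>B\<close> under \<open>T\<close>; domination guarantees that this image is again
  bounded.\<close>

lemma transpose_strong_continuous:
  fixes T :: "('a::euclidean_space \<Rightarrow> complex) \<Rightarrow> ('b::euclidean_space \<Rightarrow> complex)"
  assumes T: "\<And>f. f \<in> torus_smooth \<Longrightarrow> T f \<in> torus_smooth"
    and dom: "\<And>vs. set vs \<subseteq> Basis \<Longrightarrow> dominated (\<lambda>f. torus_seminorm vs (T f))"
    and maps: "\<And>u. u \<in> torus_dist \<Longrightarrow> (\<lambda>\<phi>\<in>torus_smooth. u (T \<phi>)) \<in> torus_dist"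
  shows "continuous_map strong_dist_topology strong_dist_topology (\<lambda>u. \<lambda>\<phi>\<in>torus_smooth. u (T \<phi>))"
  unfolding strong_dist_topology_def
proof (rule seminorm_topology_continuous_map[OF strong.seminorm_family_axioms
      strong.seminorm_family_axioms maps])
  fix p :: "(('a \<Rightarrow> complex) \<Rightarrow> complex) \<Rightarrow> real" and u :: "('b \<Rightarrow> complex) \<Rightarrow> complex" and e :: real
  assume "p \<in> {(\<lambda>u. SUP \<phi>\<in>B. norm (u \<phi>)) | B. B \<noteq> {} \<and> torus_bounded B}" and e: "0 < e"
  from this(1) obtain B where p: "p = (\<lambda>u. SUP \<phi>\<in>B. norm (u \<phi>))" and B: "B \<noteq> {}" "torus_bounded B"
    by (elim CollectE exE conjE) (rule that)
  have TB: "torus_bounded (T ` B)"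
    using B(2) T dominated_bdd_above[OF dom B(2)]
    by (auto simp: torus_bounded_def image_image)
  have eq: "p (\<lambda>i. (\<lambda>\<phi>\<in>torus_smooth. w (T \<phi>)) i - (\<lambda>\<phi>\<in>torus_smooth. u (T \<phi>)) i) =
      (SUP \<phi>\<in>T ` B. norm (w \<phi> - u \<phi>))" for w
    unfolding p image_image using B(2) by (intro SUP_cong) (auto simp: torus_bounded_def)
  have "(\<lambda>u. SUP \<phi>\<in>T ` B. norm (u \<phi>)) \<in>
      {(\<lambda>u. SUP \<phi>\<in>B. norm (u \<phi>)) | B. B \<noteq> {} \<and> torus_bounded B}"
    using B(1) TB by (intro CollectI exI[of _ "T ` B"] conjI refl) simp_all
  with e show "\<exists>Q d. finite Q \<and>
      Q \<subseteq> {(\<lambda>u. SUP \<phi>\<in>B. norm (u \<phi>)) | B. B \<noteq> {} \<and> torus_bounded B} \<and> 0 < d \<and>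
      (\<forall>w\<in>torus_dist. (\<forall>q\<in>Q. q (\<lambda>i. w i - u i) < d) \<longrightarrow>
        p (\<lambda>i. (\<lambda>\<phi>\<in>torus_smooth. w (T \<phi>)) i - (\<lambda>\<phi>\<in>torus_smooth. u (T \<phi>)) i) < e)"
    unfolding eq by (intro exI[of _ "{\<lambda>u. SUP \<phi>\<in>T ` B. norm (u \<phi>)}"] exI[of _ e] conjI) simp_all
qed

section \<open>Shears\<close>

lemma shear_compose: "shear C (shear B p) = shear (\<lambda>t. B t + C t) p"
  by (simp add: shear_def split_beta)

lemma inv_shear: "inv (shear B) = shear (\<lambda>t. - B t)"
  by (rule inv_unique_comp) (simp_all add: fun_eq_iff shear_compose, simp_all add: shear_def)

lemma Psi_fun_inverse: "Psi_fun (\<lambda>t. - B t) (Psi_fun B f) = f" "Psi_fun B (Psi_fun (\<lambda>t. - B t) f) = f"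
  by (auto simp: Psi_fun_def shear_def fun_eq_iff)

lemma Psi_fun_lincomb:
  "Psi_fun B (\<lambda>x. c * f x + d * g x) = (\<lambda>x. c * Psi_fun B f x + d * Psi_fun B g x)"
  by (simp add: Psi_fun_def fun_eq_iff)

lemma has_derivative_shear:
  assumes "(B has_real_derivative b) (at (fst p))"
  shows "(shear B has_derivative (\<lambda>v. v - (fst v * b) *\<^sub>R (0, 1))) (at p)"
proof -
  have "shear B = (\<lambda>p. p - B (fst p) *\<^sub>R (0, 1))"
    by (auto simp: shear_def fun_eq_iff)
  moreover have "((\<lambda>p. B (fst p)) has_derivative (\<lambda>v. fst v * b)) (at p)"
    using has_derivative_compose[OF has_derivative_fst[OF has_derivative_ident]
        assms[unfolded has_field_derivative_def]] by (simp add: mult.commute)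
  ultimately show ?thesis
    by (auto intro!: derivative_eq_intros)
qed

text \<open>The derivative of the shear tilts \<open>v\<close> by a multiple of the x-direction, and
  linearity in the direction splits the result. Both the seminorm bounds and the conjugation of the
  transport operators rest on this identity.\<close>

lemma dir_deriv_Psi_fun:
  fixes f :: "real \<times> real \<Rightarrow> complex"
  assumes f: "f \<in> torus_smooth" and B: "(B has_real_derivative b) (at (fst p))"
  shows "dir_deriv v (Psi_fun B f) p =
    Psi_fun B (dir_deriv v f) p - of_real (fst v * b) * Psi_fun B (dir_deriv (0, 1) f) p"
proof -
  interpret linear "\<lambda>v. dir_deriv v f (shear B p)"
    by (rule has_derivative_linear[OF torus_smooth_has_derivative[OF f]])
  have "dir_deriv (v - (fst v * b) *\<^sub>R (0, 1)) f (shear B p) =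
      dir_deriv v f (shear B p) - (fst v * b) *\<^sub>R dir_deriv (0, 1) f (shear B p)"
    by (simp only: diff scale)
  moreover have "dir_deriv v (Psi_fun B f) p = dir_deriv (v - (fst v * b) *\<^sub>R (0, 1)) f (shear B p)"
    unfolding Psi_fun_def o_def
    by (rule dir_deriv_eqI[OF has_derivative_compose
          [OF has_derivative_shear[OF B] torus_smooth_has_derivative[OF f]]])
  ultimately show ?thesis
    by (simp add: Psi_fun_def scaleR_conv_of_real)
qed

lemma torus_smooth_has_real_derivative:
  fixes B :: "real \<Rightarrow> real"
  assumes "B \<in> torus_smooth"
  shows "(B has_real_derivative dir_deriv 1 B t) (at t)"
proof -
  interpret linear "\<lambda>v. dir_deriv v B t"
    by (rule has_derivative_linear[OF torus_smooth_has_derivative[OF assms]])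
  have "dir_deriv v B t = dir_deriv 1 B t * v" for v
    using scale[of v 1] by simp
  then have "(\<lambda>v. dir_deriv v B t) = (*) (dir_deriv 1 B t)"
    by (rule ext)
  with torus_smooth_has_derivative[OF assms, of t] show ?thesis
    unfolding has_field_derivative_def by (simp only:)
qed

lemma C_k_shear:
  assumes "B \<in> torus_smooth"
  shows "C_k k (shear B)"
proof -
  have "shear B = (\<lambda>p. p + (- B (fst p)) *\<^sub>R (0, 1))"
    by (auto simp: shear_def fun_eq_iff)
  moreover have "C_k k (\<lambda>p :: real \<times> real. (- B (fst p)) *\<^sub>R (0 :: real, 1 :: real))"
    by (rule C_k_bounded_linear[OF bounded_linear_scaleR_left
          torus_smooth_C_k[OF torus_smooth_fst[OF torus_smooth_minus[OF assms]]]])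
  ultimately show ?thesis
    using C_k_add[OF C_k_ident] by (simp only:)
qed

lemma Psi_fun_smooth:
  assumes B: "B \<in> torus_smooth" and f: "f \<in> torus_smooth"
  shows "Psi_fun B f \<in> torus_smooth"
  unfolding Psi_fun_def
proof (rule torus_smoothI)
  show "C_k k (f \<circ> shear B)" for k
    unfolding o_def by (rule C_k_compose[OF torus_smooth_C_k[OF f] C_k_shear[OF B]])
  fix p b :: "real \<times> real"
  assume b: "b \<in> Basis"
  have "B (fst (p + (2 * pi) *\<^sub>R b)) = B (fst p)"
    by (rule torus_smooth_periodic[OF torus_smooth_fst[OF B] b])
  then have "shear B (p + (2 * pi) *\<^sub>R b) = shear B p + (2 * pi) *\<^sub>R b"
    by (auto simp: shear_def split_beta prod_eq_iff)
  then show "(f \<circ> shear B) (p + (2 * pi) *\<^sub>R b) = (f \<circ> shear B) p"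
    using torus_smooth_periodic[OF f b] by simp
qed

text \<open>The derivative in direction \<open>v\<close> turns \<open>Psi_fun B f\<close> into \<open>Psi_fun B\<close> of the first order
  operator \<open>\<partial>\<^sub>v - B' \<partial>\<^sub>x\<close> applied to \<open>f\<close>; hence induction on the number of derivatives.\<close>

lemma dominated_Psi_fun:
  assumes B: "B \<in> torus_smooth"
  shows "set vs \<subseteq> Basis \<Longrightarrow> dominated (\<lambda>f. torus_seminorm vs (Psi_fun B f))"
proof (induction vs rule: rev_induct)
  case Nil
  have "torus_seminorm [] (Psi_fun B f) \<le> torus_seminorm [] f" if f: "f \<in> torus_smooth" for f
  proof (rule torus_seminorm_least)
    show "norm (foldr dir_deriv [] (Psi_fun B f) p) \<le> torus_seminorm [] f" for p
      using torus_seminorm_upper[OF f, of "[]" "shear B p"] by (simp add: Psi_fun_def)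
  qed
  moreover have "dominated (torus_seminorm ([] :: (real \<times> real) list))"
    by (rule dominated.seminorm) simp
  ultimately show ?case
    by (rule dominated.mono[rotated])
next
  case (snoc v vs)
  define m where "m p = - complex_of_real (fst v) * complex_of_real (dir_deriv 1 B (fst p))"
    for p :: "real \<times> real"
  define D where "D f p = dir_deriv v f p + m p * dir_deriv (0, 1) f p"
    for f :: "real \<times> real \<Rightarrow> complex" and p
  have v: "v \<in> Basis" and vs: "set vs \<subseteq> Basis" and x: "(0, 1) \<in> (Basis :: (real \<times> real) set)"
    using snoc.prems by (auto simp: Basis_prod_def)
  have m: "m \<in> torus_smooth"
    unfolding m_def by (intro torus_smooth_mult torus_smooth_const
        torus_smooth_of_real[OF torus_smooth_fst[OF torus_smooth_dir_deriv[OF B]]])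
  have mD: "(\<lambda>p. m p * dir_deriv (0, 1) f p) \<in> torus_smooth" if "f \<in> torus_smooth" for f
    by (intro torus_smooth_mult m torus_smooth_dir_deriv that)
  have D_smooth: "D f \<in> torus_smooth" if "f \<in> torus_smooth" for f
    unfolding D_def by (intro torus_smooth_add mD torus_smooth_dir_deriv that)
  have D_dom: "dominated (\<lambda>f. torus_seminorm ws (D f))" if ws: "set ws \<subseteq> Basis" for ws
  proof (rule dominated.mono[OF dominated.add])
    show "dominated (\<lambda>f. torus_seminorm ws (dir_deriv v f))"
      by (rule dominated_dir_deriv[OF v ws])
    show "dominated (\<lambda>f. torus_seminorm ws (\<lambda>p. m p * dir_deriv (0, 1) f p))"
      using dominated_compose[OF dominated_mult[OF m ws] torus_smooth_dir_deriv
          dominated_dir_deriv[OF x]] .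
    show "torus_seminorm ws (D f) \<le> torus_seminorm ws (dir_deriv v f) +
        torus_seminorm ws (\<lambda>p. m p * dir_deriv (0, 1) f p)" if "f \<in> torus_smooth" for f
      unfolding D_def by (rule torus_seminorm_add[OF torus_smooth_dir_deriv[OF that] mD[OF that]])
  qed
  have "dominated (\<lambda>f. torus_seminorm vs (Psi_fun B (D f)))"
    using dominated_compose[OF snoc.IH[OF vs] D_smooth D_dom] .
  then show ?case
  proof (rule dominated.mono)
    fix f :: "real \<times> real \<Rightarrow> complex"
    assume "f \<in> torus_smooth"
    \<comment> \<open>The coefficient \<open>m\<close> depends only on the first coordinate, which
      the shear fixes, so it can be moved inside \<open>Psi_fun B\<close>.\<close>
    then have "dir_deriv v (Psi_fun B f) p = Psi_fun B (D f) p" for p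
      using dir_deriv_Psi_fun[OF _ torus_smooth_has_real_derivative[OF B]]
      by (simp add: D_def m_def Psi_fun_def shear_def split_beta)
    then have "dir_deriv v (Psi_fun B f) = Psi_fun B (D f)"
      by (rule ext)
    then show "torus_seminorm (vs @ [v]) (Psi_fun B f) \<le> torus_seminorm vs (Psi_fun B (D f))"
      by (simp add: torus_seminorm_def)
  qed
qed

lemma Psi_fun_continuous_map:
  assumes "B \<in> torus_smooth"
  shows "continuous_map torus_smooth_topology torus_smooth_topology (Psi_fun B)"
  by (rule torus_smooth_continuous_map)
    (auto simp: Psi_fun_smooth dominated_Psi_fun assms, simp add: Psi_fun_def o_def)

section \<open>The action of shears on distributions\<close>

lemma jacobian2_shear:
  assumes B: "B \<in> torus_smooth"
  shows "jacobian2 (shear B) p = 1"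
proof -
  have "dir_deriv v (shear B) p = v - (fst v * dir_deriv 1 B (fst p)) *\<^sub>R (0, 1)" for v
    by (rule dir_deriv_eqI[OF has_derivative_shear[OF torus_smooth_has_real_derivative[OF B]]])
  then show ?thesis
    by (simp add: jacobian2_def)
qed

lemma Psi_dist_eq:
  assumes "B \<in> torus_smooth"
  shows "Psi_dist B = (\<lambda>u. \<lambda>\<phi>\<in>torus_smooth. u (Psi_fun (\<lambda>t. - B t) \<phi>))"
  by (simp add: Psi_dist_def dist_pullback_def[abs_def] inv_shear jacobian2_shear torus_smooth_minus[OF assms]
      Psi_fun_def o_def)

lemma Psi_dist_torus_dist:
  "B \<in> torus_smooth \<Longrightarrow> u \<in> torus_dist \<Longrightarrow> Psi_dist B u \<in> torus_dist"
  unfolding Psi_dist_eq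
  by (intro torus_dist_transpose Psi_fun_continuous_map torus_smooth_minus Psi_fun_lincomb)

lemma Psi_dist_inverse:
  fixes u :: "(real \<times> real \<Rightarrow> complex) \<Rightarrow> complex"
  assumes B: "B \<in> torus_smooth" and u: "u \<in> torus_dist"
  shows "Psi_dist (\<lambda>t. - B t) (Psi_dist B u) = u"
proof -
  \<comment> \<open>Off the test functions the left side is \<open>undefined\<close> by restriction;
    extensionality gives the same for \<open>u\<close>.\<close>
  have "u \<in> extensional torus_smooth"
    using u by (simp add: torus_dist_def)
  then show ?thesis
    using B by (auto simp: Psi_dist_eq torus_smooth_minus Psi_fun_smooth Psi_fun_inverse
        fun_eq_iff restrict_def extensional_def)
qed

lemma Psi_dist_linear:
  assumes "B \<in> torus_smooth"
  shows "complex_linear_on torus_smooth torus_dist (Psi_dist B)"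
  using assms by (auto simp: complex_linear_on_def Psi_dist_eq Psi_fun_smooth torus_smooth_minus
      fun_eq_iff restrict_def)

text \<open>The topology stays a parameter because linearity and inversion are the same for the weak
  and the strong one; only \<open>cont\<close> differs.\<close>

lemma Psi_dist_inverse_automorphisms:
  assumes B: "B \<in> torus_smooth"
    and X: "topspace X = torus_dist"
    and cont: "\<And>C. C \<in> torus_smooth \<Longrightarrow> continuous_map X X (Psi_dist C)"
  shows "inverse_automorphisms torus_smooth X (Psi_dist B) (Psi_dist (\<lambda>t. - B t))"
  unfolding inverse_automorphisms_def homeomorphic_maps_def X
  using Psi_dist_inverse[OF B] Psi_dist_inverse[OF torus_smooth_minus[OF B]]
  by (simp add: Psi_dist_linear cont torus_smooth_minus B)

lemma Psi_dist_weak_continuous: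
  assumes B: "B \<in> torus_smooth"
  shows "continuous_map weak_dist_topology weak_dist_topology (Psi_dist B)"
  unfolding Psi_dist_eq[OF B]
proof (rule transpose_weak_continuous)
  show "Psi_fun (\<lambda>t. - B t) f \<in> torus_smooth" if "f \<in> torus_smooth" for f :: "real \<times> real \<Rightarrow> complex"
    by (intro Psi_fun_smooth torus_smooth_minus B that)
  show "(\<lambda>\<phi>\<in>torus_smooth. u (Psi_fun (\<lambda>t. - B t) \<phi>)) \<in> torus_dist" if "u \<in> torus_dist" for u
    using Psi_dist_torus_dist[OF B that] by (simp add: Psi_dist_eq[OF B])
qed

lemma Psi_dist_strong_continuous:
  assumes B: "B \<in> torus_smooth"
  shows "continuous_map strong_dist_topology strong_dist_topology (Psi_dist B)"
  unfolding Psi_dist_eq[OF B]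
proof (rule transpose_strong_continuous)
  show "Psi_fun (\<lambda>t. - B t) f \<in> torus_smooth" if "f \<in> torus_smooth" for f :: "real \<times> real \<Rightarrow> complex"
    by (intro Psi_fun_smooth torus_smooth_minus B that)
  show "dominated (\<lambda>f. torus_seminorm vs (Psi_fun (\<lambda>t. - B t) f))" if "set vs \<subseteq> Basis" for vs
    by (intro dominated_Psi_fun torus_smooth_minus B that)
  show "(\<lambda>\<phi>\<in>torus_smooth. u (Psi_fun (\<lambda>t. - B t) \<phi>)) \<in> torus_dist" if "u \<in> torus_dist" for u
    using Psi_dist_torus_dist[OF B that] by (simp add: Psi_dist_eq[OF B])
qed

lemma Psi_fun_inverse_automorphisms:
  assumes B: "B \<in> torus_smooth"
  shows "inverse_automorphisms UNIV torus_smooth_topology (Psi_fun B) (Psi_fun (\<lambda>t. - B t))"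
  unfolding inverse_automorphisms_def homeomorphic_maps_def complex_linear_on_def
  by (simp add: restrict_def Psi_fun_lincomb Psi_fun_inverse Psi_fun_continuous_map torus_smooth_minus B)

section \<open>Conjugation of the transport operators\<close>

text \<open>The t-derivative of a sheared function gains \<open>- (b t - c t)\<close> times the
  sheared x-derivative, which turns the coefficient \<open>c\<close> into \<open>b\<close>;
  x-derivatives commute with the shear.\<close>

lemma Psi_fun_transport_fun:
  fixes f :: "real \<times> real \<Rightarrow> complex"
  assumes f: "f \<in> torus_smooth" and B: "\<And>t. (B has_real_derivative b t - c t) (at t)"
  shows "Psi_fun B (transport_fun b f) = transport_fun c (Psi_fun B f)"
proof (rule ext, clarify)
  fix t x :: real
  have "dir_deriv v (Psi_fun B f) (t, x) =
      Psi_fun B (dir_deriv v f) (t, x) - of_real (fst v * (b t - c t)) * Psi_fun B (dir_deriv (0, 1) f) (t, x)"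
    for v
    by (rule dir_deriv_Psi_fun[OF f]) (simp add: B)
  then show "Psi_fun B (transport_fun b f) (t, x) = transport_fun c (Psi_fun B f) (t, x)"
    by (simp add: transport_fun_def) (simp add: Psi_fun_def shear_def algebra_simps)
qed

lemma transport_fun_smooth:
  fixes \<phi> :: "real \<times> real \<Rightarrow> complex"
  assumes "b \<in> torus_smooth" "\<phi> \<in> torus_smooth"
  shows "transport_fun b \<phi> \<in> torus_smooth"
  unfolding transport_fun_def split_beta prod.collapse
  by (intro torus_smooth_diff torus_smooth_mult torus_smooth_of_real[OF torus_smooth_fst]
      torus_smooth_dir_deriv assms)

lemma transport_dist_eq:
  fixes \<phi> :: "real \<times> real \<Rightarrow> complex"
  assumes u: "u \<in> torus_dist" and b: "b \<in> torus_smooth" and \<phi>: "\<phi> \<in> torus_smooth"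
  shows "transport_dist b u \<phi> = - u (transport_fun b \<phi>)"
proof -
  define m where "m p = complex_of_real (b (fst p))" for p :: "real \<times> real"
  have m: "m \<in> torus_smooth"
    unfolding m_def by (rule torus_smooth_of_real[OF torus_smooth_fst[OF b]])
  \<comment> \<open>The coefficient is constant in x, so moving the x-derivative across it leaves no
    zero order term.\<close>
  have "dir_deriv (0, 1) m p = 0" for p
  proof -
    have "(b has_derivative (\<lambda>v. v * dir_deriv 1 b (fst p))) (at (fst p))"
      using torus_smooth_has_real_derivative[OF b, of "fst p"]
      by (simp add: has_field_derivative_def mult.commute[of _ "dir_deriv 1 b (fst p)"])
    then have "(m has_derivative (\<lambda>v. complex_of_real (fst v * dir_deriv 1 b (fst p)))) (at p)"
      unfolding m_def
      by (intro has_derivative_of_real has_derivative_compose[OF has_derivative_fst[OF has_derivative_ident]])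
    then show ?thesis
      by (simp add: dir_deriv_eqI)
  qed
  then have x: "dir_deriv (0, 1) (\<lambda>p. m p * \<phi> p) = (\<lambda>p. m p * dir_deriv (0, 1) \<phi> p)"
    by (simp add: dir_deriv_mult m \<phi>)
  have "transport_dist b u \<phi> = - u (dir_deriv (1, 0) \<phi>) + u (\<lambda>p. m p * dir_deriv (0, 1) \<phi> p)"
    using x torus_smooth_mult[OF m \<phi>]
    by (simp add: transport_dist_def dist_deriv_def dist_mult_def m_def[symmetric] split_beta \<phi>)
  also have "\<dots> = - u (\<lambda>p. 1 * dir_deriv (1, 0) \<phi> p + (-1) * (m p * dir_deriv (0, 1) \<phi> p))"
    by (subst torus_dist_lincomb[OF u])
      (simp_all add: torus_smooth_mult torus_smooth_dir_deriv m \<phi>)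
  also have "(\<lambda>p. 1 * dir_deriv (1, 0) \<phi> p + (-1) * (m p * dir_deriv (0, 1) \<phi> p)) = transport_fun b \<phi>"
    by (simp add: transport_fun_def m_def fun_eq_iff)
  finally show ?thesis .
qed

lemma Psi_dist_transport_dist:
  assumes B: "B \<in> torus_smooth" and b: "b \<in> torus_smooth" and c: "c \<in> torus_smooth"
    and deriv: "\<And>t. (B has_real_derivative b t - c t) (at t)" and u: "u \<in> torus_dist"
  shows "Psi_dist B (transport_dist b u) = transport_dist c (Psi_dist B u)"
proof
  fix \<phi> :: "real \<times> real \<Rightarrow> complex"
  \<comment> \<open>On test functions the opposite shear acts, and its derivative exchanges the
    roles of \<open>b\<close> and \<open>c\<close>.\<close>
  have deriv': "((\<lambda>t. - B t) has_real_derivative c t - b t) (at t)" for t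
    using DERIV_minus[OF deriv[of t]] by simp
  show "Psi_dist B (transport_dist b u) \<phi> = transport_dist c (Psi_dist B u) \<phi>"
  proof (cases "\<phi> \<in> torus_smooth")
    case True
    then have "Psi_dist B (transport_dist b u) \<phi> = - u (transport_fun b (Psi_fun (\<lambda>t. - B t) \<phi>))"
      by (simp add: Psi_dist_eq B transport_dist_eq u b Psi_fun_smooth torus_smooth_minus)
    also have "\<dots> = - u (Psi_fun (\<lambda>t. - B t) (transport_fun c \<phi>))"
      by (simp only: Psi_fun_transport_fun[OF True deriv'])
    also have "\<dots> = - Psi_dist B u (transport_fun c \<phi>)"
      using True by (simp add: Psi_dist_eq B transport_fun_smooth c)
    also have "\<dots> = transport_dist c (Psi_dist B u) \<phi>"
      by (simp add: transport_dist_eq Psi_dist_torus_dist True B c u)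
    finally show ?thesis .
  qed (simp add: Psi_dist_eq B transport_dist_def)
qed

section \<open>Partial Fourier coefficients\<close>

lemma torus_smooth_exp:
  fixes g :: "'a::euclidean_space \<Rightarrow> complex"
  assumes "g \<in> torus_smooth"
  shows "(\<lambda>x. exp (g x)) \<in> torus_smooth"
  by (rule torus_smoothI[OF C_k_compose[OF C_k_exp torus_smooth_C_k[OF assms]]])
    (simp add: torus_smooth_periodic[OF assms])

lemma torus_smooth_snd_character:
  "(\<lambda>p :: real \<times> real. exp (- \<i> * complex_of_real (snd p) * of_int \<xi>)) \<in> torus_smooth"
proof (rule torus_smoothI)
  show "C_k k (\<lambda>p :: real \<times> real. exp (- \<i> * complex_of_real (snd p) * of_int \<xi>))" for k
    by (intro C_k_compose[OF C_k_exp] C_k_mult C_k_const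
        C_k_bounded_linear[OF bounded_linear_of_real] C_k_bounded_linear[OF bounded_linear_snd C_k_ident])
  show "exp (- \<i> * complex_of_real (snd (p + (2 * pi) *\<^sub>R b)) * of_int \<xi>) =
      exp (- \<i> * complex_of_real (snd p) * of_int \<xi>)" if "b \<in> Basis" for p b :: "real \<times> real"
  proof (cases "snd b = 0")
    case False
    then have "snd b = 1"
      using that by (auto simp: Basis_prod_def)
    \<comment> \<open>A period in x changes the exponent by \<open>- 2 * pi * \<xi>\<close> times
      the imaginary unit; the integer required by \<open>exp_eq\<close> is therefore
      \<open>- \<xi>\<close>.\<close>
    then show ?thesis
      by (intro exp_eq[THEN iffD2] exI[of _ "- \<xi>"]) (simp add: algebra_simps)
  qed simp
qed

lemma partial_fourier_Psi_dist:
  assumes B: "B \<in> torus_smooth"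
  shows "partial_fourier (Psi_dist B u) \<xi> =
    dist_mult (\<lambda>t. exp (- \<i> * of_int \<xi> * complex_of_real (B t))) (partial_fourier u \<xi>)"
proof
  fix \<psi> :: "real \<Rightarrow> complex"
  define m where "m = (\<lambda>t. exp (- \<i> * of_int \<xi> * complex_of_real (B t)))"
  define \<eta> where "\<eta> h = (\<lambda>(t, x). h t * exp (- \<i> * complex_of_real x * of_int \<xi>))"
    for h :: "real \<Rightarrow> complex"
  have m: "m \<in> torus_smooth"
    unfolding m_def
    by (intro torus_smooth_exp torus_smooth_mult torus_smooth_const torus_smooth_of_real B)
  have pf: "partial_fourier w \<xi> h = 1 / (2 * complex_of_real pi) * w (\<eta> h)"
    if "h \<in> torus_smooth" for w h
    using that by (simp add: partial_fourier_def \<eta>_def)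
  have \<eta>_smooth: "\<eta> h \<in> torus_smooth" if "h \<in> torus_smooth" for h
    unfolding \<eta>_def split_beta
    by (intro torus_smooth_mult torus_smooth_fst torus_smooth_snd_character that)
  \<comment> \<open>The transposed shear replaces x by \<open>x + B t\<close>, and the character
    splits off a factor depending on t alone. This fixes the sign of the exponent in
    \<open>m\<close>.\<close>
  have shift: "Psi_fun (\<lambda>t. - B t) (\<eta> \<psi>) = \<eta> (\<lambda>t. m t * \<psi> t)"
    by (simp add: Psi_fun_def shear_def \<eta>_def m_def fun_eq_iff exp_add[symmetric] algebra_simps)
  show "partial_fourier (Psi_dist B u) \<xi> \<psi> =
      dist_mult (\<lambda>t. exp (- \<i> * of_int \<xi> * complex_of_real (B t))) (partial_fourier u \<xi>) \<psi>"
    unfolding m_def[symmetric]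
  proof (cases "\<psi> \<in> torus_smooth")
    case True
    then show "partial_fourier (Psi_dist B u) \<xi> \<psi> = dist_mult m (partial_fourier u \<xi>) \<psi>"
      by (simp add: pf dist_mult_def Psi_dist_eq[OF B] \<eta>_smooth shift torus_smooth_mult[OF m])
  qed (simp add: partial_fourier_def dist_mult_def)
qed

section \<open>The primitive of the mean-free part\<close>

lemma C_k_antiderivative:
  fixes F g :: "real \<Rightarrow> real"
  assumes F: "\<And>t. (F has_real_derivative g t) (at t)" and g: "\<And>k. C_k k g"
  shows "C_k k F"
  \<comment> \<open>One order too many is proved and then dropped, so that \<open>k = 0\<close>
    needs no separate case.\<close>
  by (rule C_k_SucD, rule C_k_SucI[OF F[unfolded has_field_derivative_def]])
    (intro C_k_mult g C_k_const)

lemma interval_integral_has_real_derivative: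
  fixes g :: "real \<Rightarrow> real"
  assumes g: "continuous_on UNIV g"
  shows "((\<lambda>t. LBINT s=0..ereal t. g s) has_real_derivative g t) (at t)"
proof -
  \<comment> \<open>An interval with both 0 and \<open>t\<close> in its interior: the integral may
    start at 0 for either sign of \<open>t\<close>, and the derivative within the interval is the
    full derivative.\<close>
  define M where "M = \<bar>t\<bar> + 1"
  have "((\<lambda>t. LBINT s=ereal 0..ereal t. g s) has_vector_derivative g t) (at t within {- M..M})"
    by (rule interval_integral_FTC2) (auto simp: M_def intro: continuous_on_subset[OF g])
  moreover have "at t within {- M..M} = at t"
    by (rule at_within_Icc_at) (auto simp: M_def)
  ultimately show ?thesis
    by (simp add: has_real_derivative_iff_has_vector_derivative zero_ereal_def)
qed

text \<open>Periodicity of \<open>a\<close> makes \<open>A (t + 2 * pi) - A t\<close> constant in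
  \<open>t\<close>. Its value is the integral of \<open>a\<close> over a period minus
  \<open>2 * pi * a0\<close>, which vanishes by the choice of \<open>a0\<close> as the mean.\<close>

lemma mean_free_primitive_smooth:
  fixes a :: "real \<Rightarrow> real"
  assumes a: "a \<in> torus_smooth"
    and a0: "a0 = 1 / (2 * pi) * (LBINT t=0..ereal (2 * pi). a t)"
    and A: "\<And>t. (A has_real_derivative a t - a0) (at t)"
  shows "A \<in> torus_smooth"
proof (rule torus_smoothI)
  have "(\<lambda>t. a t - a0) \<in> torus_smooth"
    by (intro torus_smooth_diff a torus_smooth_const)
  then show "C_k k A" for k
    by (rule C_k_antiderivative[OF A torus_smooth_C_k])
  have "((\<lambda>t. A (t + 2 * pi) - A t) has_real_derivative 0) (at t)" for t
  proof -
    have "a (t + 2 * pi) = a t"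
      using torus_smooth_periodic[OF a, of 1 t] by simp
    moreover have "((\<lambda>t. A (t + 2 * pi)) has_real_derivative a (t + 2 * pi) - a0) (at t)"
      using A[of "t + 2 * pi"] by (simp add: DERIV_shift)
    ultimately show ?thesis
      using DERIV_diff[OF _ A[of t]] by fastforce
  qed
  then have const: "A (t + 2 * pi) - A t = A (0 + 2 * pi) - A 0" for t
    using DERIV_isconst_all[of "\<lambda>t. A (t + 2 * pi) - A t" t 0] by blast
  \<comment> \<open>Comparing two primitives of \<open>a\<close> evaluates
    \<open>A (2 * pi) - A 0\<close> from the derivative of \<open>A\<close> alone.\<close>
  have "((\<lambda>t. (LBINT s=0..ereal t. a s) - (A t + a0 * t)) has_real_derivative 0) (at t)" for t
    using interval_integral_has_real_derivative[OF torus_smooth_continuous_on[OF a]] A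
    by (auto intro!: derivative_eq_intros)
  from DERIV_isconst_all[of "\<lambda>t. (LBINT s=0..ereal t. a s) - (A t + a0 * t)" "2 * pi" 0] this
  have "(LBINT s=0..ereal (2 * pi). a s) - (A (2 * pi) + a0 * (2 * pi)) = - A 0"
    by (simp add: zero_ereal_def)
  then have "A (2 * pi) = A 0"
    by (simp add: a0)
  with const show "A (t + (2 * pi) *\<^sub>R b) = A t" if "b \<in> Basis" for t b
    using that by (simp add: eq_iff_diff_eq_0[symmetric])
qed

theorem proposition6p1:
  fixes a A :: "real \<Rightarrow> real" and a0 :: real
  assumes a: "a \<in> torus_smooth"
    and a0: "a0 = 1 / (2 * pi) * (LBINT t=0..ereal (2 * pi). a t)"
    and A: "A = (\<lambda>t. LBINT s=0..ereal t. (a s - a0))"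
  shows "A \<in> torus_smooth \<and>
         inverse_automorphisms torus_smooth weak_dist_topology
           (Psi_dist A) (Psi_dist (\<lambda>t. - A t)) \<and>
         inverse_automorphisms torus_smooth strong_dist_topology
           (Psi_dist A) (Psi_dist (\<lambda>t. - A t)) \<and>
         inverse_automorphisms UNIV torus_smooth_topology
           (Psi_fun A) (Psi_fun (\<lambda>t. - A t)) \<and>
         (\<forall>u\<in>torus_dist.
           Psi_dist A (transport_dist a u) = transport_dist (\<lambda>_. a0) (Psi_dist A u)) \<and>
         (\<forall>u\<in>torus_dist.
           Psi_dist (\<lambda>t. - A t) (transport_dist (\<lambda>_. a0) u) =
           transport_dist a (Psi_dist (\<lambda>t. - A t) u)) \<and>
         (\<forall>f\<in>torus_smooth.
           Psi_fun A (transport_fun a f) = transport_fun (\<lambda>_. a0) (Psi_fun A f)) \<and>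
         (\<forall>f\<in>torus_smooth.
           Psi_fun (\<lambda>t. - A t) (transport_fun (\<lambda>_. a0) f) =
           transport_fun a (Psi_fun (\<lambda>t. - A t) f)) \<and>
         (\<forall>u\<in>torus_dist. \<forall>\<xi>::int.
           partial_fourier (Psi_dist A u) \<xi> =
           dist_mult (\<lambda>t. exp (- \<i> * of_int \<xi> * complex_of_real (A t))) (partial_fourier u \<xi>)) \<and>
         (\<forall>u\<in>torus_dist. \<forall>\<xi>::int.
           partial_fourier (Psi_dist (\<lambda>t. - A t) u) \<xi> =
           dist_mult (\<lambda>t. exp (\<i> * of_int \<xi> * complex_of_real (A t))) (partial_fourier u \<xi>))"
proof -
  have "continuous_on UNIV (\<lambda>t. a t - a0)"
    by (intro continuous_intros torus_smooth_continuous_on[OF a])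
  then have deriv: "(A has_real_derivative a t - a0) (at t)" for t
    unfolding A by (rule interval_integral_has_real_derivative)
  then have deriv': "((\<lambda>t. - A t) has_real_derivative a0 - a t) (at t)" for t
    using DERIV_minus[OF deriv[of t]] by simp
  have A_smooth: "A \<in> torus_smooth"
    by (rule mean_free_primitive_smooth[OF a a0 deriv])
  note A_minus = torus_smooth_minus[OF A_smooth]
  show ?thesis
    \<comment> \<open>For \<open>\<lambda>t. - A t\<close> the exponent carries two minus signs,
      which the closing simplification cancels.\<close>
    using partial_fourier_Psi_dist[OF A_minus]
    by (intro conjI ballI allI A_smooth Psi_fun_inverse_automorphisms
        Psi_dist_inverse_automorphisms[OF A_smooth topspace_weak_dist Psi_dist_weak_continuous]
        Psi_dist_inverse_automorphisms[OF A_smooth topspace_strong_dist Psi_dist_strong_continuous]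
        Psi_dist_transport_dist A_minus a torus_smooth_const deriv deriv' Psi_fun_transport_fun
        partial_fourier_Psi_dist) (simp_all)
qed

end
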